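(* Let $N\geq2$, $1\leq d<N$ be integers, $0<p<q\leq\infty$ and $s>\sigma_p$. Then there exists a function $f\in B_{p,q}^s(\mathbb{R}^N)$ such that $$f(\cdot,y)\notin A^{s,p}(\mathbb{R}^d)\qquad\text{for a.e. } y\in\mathbb{R}^{N-d}.$$
   Context: $\sigma_p:=N\left(\frac1p-1\right)_+$ with $x_+=\max\{0,x\}$. Points of $\mathbb{R}^N$ are written $(x,y)$ with $x\in\mathbb{R}^d$, $y\in\mathbb{R}^{N-d}$, and $f(\cdot,y)$ is the function $x\mapsto f(x,y)$ on $\mathbb{R}^d$. For $M\in\{1,2,\dots\}$ and $h\in\mathbb{R}^n$, $\Delta_h^Mf(x)=\sum_{j=0}^M(-1)^{M-j}\binom{M}{j}f(x+hj)$. For $n\geq1$, $0<p,q\leq\infty$, $s>n(\frac1p-1)_+$ with $s>0$, and an integer $M>s$, the Besov space $B_{p,q}^s(\mathbb{R}^n)$ is the set of all $f\in L^p(\mathbb{R}^n)$ with $$[f]_{B_{p,q}^s(\mathbb{R}^n)}:=\left(\int_{|h|\leq1}\|\Delta_h^Mf\|_{L^p(\mathbb{R}^n)}^q\frac{\mathrm{d}h}{|h|^{n+sq}}\right)^{1/q}<\infty,$$ which for $q=\infty$ means $\sup_{0<|h|\leq1}|h|^{-s}\|\Delta_h^Mf\|_{L^p(\mathbb{R}^n)}<\infty$. Different choices of $M>s$ give the same space with equivalent quasi-norms. For $n\ge 1$, the space $A^{s,p}(\mathbb{R}^n)$ is: (i) if $sp>n$: $A^{s,p}(\mathbb{R}^n)=C^{s-\frac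 np}(\mathbb{R}^n)$, where for $\alpha>0$ the Zygmund–Hölder space is $C^{\alpha}(\mathbb{R}^n):=B_{\infty,\infty}^{\alpha}(\mathbb{R}^n)$; (ii) if $sp=n$: $A^{s,p}(\mathbb{R}^n)=\mathrm{BMO}(\mathbb{R}^n)$, the space of locally integrable $g$ with $\sup_B \frac{1}{|B|}\int_B|g(x)-g_B|\,\mathrm{d}x<\infty$, the supremum being over all balls $B\subset\mathbb{R}^n$, where $g_B=\frac1{|B|}\int_B g$; (iii) if $sp<n$: $A^{s,p}(\mathbb{R}^n)=L^{\frac{np}{n-sp},\infty}(\mathbb{R}^n)$, where $L^{\rho,\infty}(\mathbb{R}^n)$ is the space of measurable $g$ with $\sup_{t>0}t^{1/\rho}g^*(t)<\infty$, $g^*(t):=\inf\{\lambda\geq0:|\{x\in\mathbb{R}^n:|g(x)|>\lambda\}|\leq t\}$ being the decreasing rearrangement. Thus $A^{s,p}(\mathbb{R}^d)$ is given by these formulas with $n=d$. *)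

theory Defs
  imports "HOL-Probability.Essential_Supremum"
begin

text \<open>
  Function spaces are sets of (Lebesgue measurable, real-valued) functions on a Euclidean space,
  not of equivalence classes; membership in each of them is invariant under changing a function
  on a null set. The dimension \<open>n\<close> of the underlying space is \<open>DIM('a)\<close>.
\<close>

definition sigma_p :: "nat \<Rightarrow> real \<Rightarrow> real" where
  "sigma_p N p = real N * max 0 (1 / p - 1)"

text \<open>Used for positive exponents only.\<close>

definition ennpowr :: "ennreal \<Rightarrow> real \<Rightarrow> ennreal" where
  "ennpowr x r = (if x = \<infinity> then \<infinity> else ennreal (enn2real x powr r))"

definition Lp_norm :: "ennreal \<Rightarrow> ('a::euclidean_space \<Rightarrow> real) \<Rightarrow> ennreal" where
  "Lp_norm p f =
     (if p = \<infinity> then esssup lebesgue (\<lambda>x. ennreal \<bar>f x\<bar>)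
      else ennpowr (\<integral>\<^sup>+ x. ennreal (\<bar>f x\<bar> powr enn2real p) \<partial>lebesgue) (1 / enn2real p))"

definition Lp_space :: "ennreal \<Rightarrow> ('a::euclidean_space \<Rightarrow> real) set" where
  "Lp_space p = {f. f \<in> borel_measurable lebesgue \<and> Lp_norm p f < \<infinity>}"

definition fin_diff :: "nat \<Rightarrow> 'a::euclidean_space \<Rightarrow> ('a \<Rightarrow> real) \<Rightarrow> 'a \<Rightarrow> real" where
  "fin_diff M h f x = (\<Sum>j\<le>M. (-1) ^ (M - j) * real (M choose j) * f (x + real j *\<^sub>R h))"

text \<open>In the integral, the junk value of \<open>0 powr r\<close> at \<open>h = 0\<close> affects only a null set.\<close>

definition besov_seminorm ::
    "nat \<Rightarrow> real \<Rightarrow> ennreal \<Rightarrow> ennreal \<Rightarrow> ('a::euclidean_space \<Rightarrow> real) \<Rightarrow> ennreal" where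
  "besov_seminorm M s p q f =
     (if q = \<infinity>
      then SUP h\<in>{h. 0 < norm h \<and> norm h \<le> 1}.
             ennreal (norm h powr - s) * Lp_norm p (fin_diff M h f)
      else ennpowr
             (\<integral>\<^sup>+ h\<in>{h. norm h \<le> 1}.
                (ennpowr (Lp_norm p (fin_diff M h f)) (enn2real q)
                   * ennreal (norm h powr - (real DIM('a) + s * enn2real q))) \<partial>lebesgue)
             (1 / enn2real q))"

text \<open>
  For \<open>s > max 0 (n (1/p - 1))\<close> all integers \<open>M > s\<close> define the same space;
  we take the smallest one.
\<close>

definition besov_space :: "real \<Rightarrow> ennreal \<Rightarrow> ennreal \<Rightarrow> ('a::euclidean_space \<Rightarrow> real) set" where
  "besov_space s p q = {f \<in> Lp_space p. besov_seminorm (nat \<lfloor>s\<rfloor> + 1) s p q f < \<infinity>}"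

definition zygmund_space :: "real \<Rightarrow> ('a::euclidean_space \<Rightarrow> real) set" where
  "zygmund_space \<alpha> = besov_space \<alpha> \<infinity> \<infinity>"

definition mean_on :: "'a::euclidean_space set \<Rightarrow> ('a \<Rightarrow> real) \<Rightarrow> real" where
  "mean_on B g = (1 / measure lebesgue B) * (LINT x:B|lebesgue. g x)"

definition bmo_space :: "('a::euclidean_space \<Rightarrow> real) set" where
  "bmo_space =
     {g. (\<forall>K. compact K \<longrightarrow> set_integrable lebesgue K g) \<and>
         (\<exists>C. \<forall>z r. 0 < r \<longrightarrow> mean_on (ball z r) (\<lambda>x. \<bar>g x - mean_on (ball z r) g\<bar>) \<le> C)}"

definition decr_rearr :: "('a::euclidean_space \<Rightarrow> real) \<Rightarrow> real \<Rightarrow> ennreal" where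
  "decr_rearr g t =
     (INF c\<in>{c::real. 0 \<le> c \<and> emeasure lebesgue {x. \<bar>g x\<bar> > c} \<le> ennreal t}. ennreal c)"

definition weak_Lp_space :: "real \<Rightarrow> ('a::euclidean_space \<Rightarrow> real) set" where
  "weak_Lp_space \<rho> =
     {g. g \<in> borel_measurable lebesgue \<and>
         (SUP t\<in>{0<..}. ennreal (t powr (1 / \<rho>)) * decr_rearr g t) < \<infinity>}"

definition A_space :: "real \<Rightarrow> real \<Rightarrow> ('a::euclidean_space \<Rightarrow> real) set" where
  "A_space s p =
     (let n = real DIM('a) in
        if s * p > n then zygmund_space (s - n / p)
        else if s * p = n then bmo_space
        else weak_Lp_space (n * p / (n - s * p)))"

end

theory Submission
  imports Defs
begin

text \<open>
  Write \<open>d\<close> and \<open>m\<close> for the dimensions of the factors that contain \<open>x\<close> and \<open>y\<close>.  The function is a sum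
  of rescaled copies of one bump, sitting in pairwise disjoint balls.  A copy of radius \<open>2\<^sup>-\<^sup>n\<close> has
  height \<open>\<lambda>\<^sub>n 2 powr (n (d/p - s))\<close>.  For \<open>\<lambda>\<^sub>n = 1\<close> this is the normalisation under which the single
  bump, restricted to a slice through its inner half, has size comparable to \<open>1\<close> in the space \<open>A\<^sup>s\<^sup>,\<^sup>p\<close>,
  because its seminorm scales with the exponent \<open>s - d/p\<close> in all of its three ranges.  So a slice that
  meets bumps with unbounded \<open>\<lambda>\<^sub>n\<close> in their inner halves is not in \<open>A\<^sup>s\<^sup>,\<^sup>p\<close> (\<open>tall_peaks_slice\<close>,
  \<open>tall_peaks_imp_not_A_space\<close>).

  On the whole space, the bumps of radius \<open>2\<^sup>-\<^sup>n\<close>, \<open>k\<^sub>n\<close> in number, contribute to the \<open>p\<close>-th power of the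
  Besov quasi-norm the amount \<open>a\<^sub>n = k\<^sub>n \<lambda>\<^sub>n\<^sup>p 2\<^sup>-\<^sup>n\<^sup>m\<close>, which is \<open>\<lambda>\<^sub>n\<^sup>p\<close> times the volume of the set of
  parameters \<open>y\<close> that they reach, up to constants.  Contributions of different \<open>n\<close> are summed
  in \<open>\<ell>\<^sup>q\<close>, so what has to be finite is \<open>\<Sum>n. a\<^sub>n powr (q/p)\<close> (\<open>spike_sum_in_besov_space\<close>).
  Here \<open>p < q\<close> enters: every \<open>y\<close> must be reached infinitely often with \<open>\<lambda>\<^sub>n\<close> unbounded, which
  forces \<open>\<Sum>n. a\<^sub>n = \<infinity>\<close>; but if a cube is cut into \<open>J\<close> equal cells and each cell is served by a
  level of its own, then the cube costs \<open>J\<close> times a multiple of \<open>J powr (- q/p)\<close>, which is as small as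
  desired (\<open>sparse_covering_exists\<close>).  The cubes exhaust the space while \<open>\<lambda>\<close> grows from cube to cube,
  so that every single \<open>y\<close> is bad.

  Two devices keep the estimates elementary.  Since the bumps are far apart in the direction of \<open>x\<close>,
  the finite differences with \<open>norm h \<le> 1\<close> of different bumps have disjoint supports, and the
  \<open>p\<close>-th powers of the \<open>L\<^sup>p\<close> quasi-norms simply add up, for \<open>p < 1\<close> as well as for \<open>p \<ge> 1\<close>.  And on
  the dyadic shell \<open>norm h \<approx> 2\<^sup>-\<^sup>l\<close> level \<open>n\<close> is damped by a factor \<open>r ^ \<bar>n - l\<bar>\<close> with \<open>r < 1\<close>, by
  smoothness of the bump if \<open>n < l\<close> and by \<open>s > 0\<close> if \<open>n > l\<close>; a discrete Young inequality does
  the rest.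
\<close>

section \<open>Auxiliary estimates for powers and quasi-norms\<close>

lemma ennpowr_mono:
  assumes "x \<le> ennreal a" "0 \<le> a" "0 \<le> r"
  shows "ennpowr x r \<le> ennreal (a powr r)"
proof -
  have "x \<noteq> \<infinity>" using assms(1) by (auto simp: top_unique)
  then obtain b where b: "x = ennreal b" "b \<ge> 0" by (cases x) auto
  with assms have "b \<le> a" by (simp add: ennreal_le_iff)
  then show ?thesis using b assms by (auto simp: ennpowr_def intro!: ennreal_leI powr_mono2)
qed

lemma Lp_norm_le:
  assumes "0 < p" "0 \<le> X" "(\<integral>\<^sup>+z. ennreal (\<bar>f z\<bar> powr p) \<partial>lebesgue) \<le> ennreal X"
  shows "Lp_norm (ennreal p) f \<le> ennreal (X powr (1 / p))"
  using assms ennpowr_mono[OF assms(3,2), of "1 / p"] by (simp add: Lp_norm_def)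

lemma ennpowr_less_top: "x < top \<Longrightarrow> ennpowr x r < top"
  by (simp add: ennpowr_def)

lemma half_power_eq_powr: "(1 / 2 :: real) ^ n = 2 powr (- real n)"
  by (simp add: powr_minus powr_realpow power_one_over inverse_eq_divide)

lemma dyadic_shell:
  fixes x :: real
  assumes "0 < x" "x \<le> 1"
  obtains l where "(1/2) ^ Suc l < x" "x \<le> (1/2) ^ l"
proof -
  define n where "n = (LEAST n. (1/2::real) ^ n < x)"
  have ex: "\<exists>n. (1/2::real) ^ n < x" using real_arch_pow_inv[OF assms(1), of "1/2"] by auto
  have 1: "(1/2) ^ n < x" unfolding n_def by (rule LeastI_ex[OF ex])
  then have "n \<noteq> 0" using assms(2) by (cases n) auto
  then obtain l where l: "n = Suc l" by (cases n) auto
  have "\<not> (1/2) ^ l < x" using not_less_Least[of l "\<lambda>n. (1/2::real) ^ n < x"] l by (simp add: n_def)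
  then show ?thesis using that[of l] 1 l by simp
qed

section \<open>Finite differences of compactly supported bumps\<close>

text \<open>
  Pascal's rule turns the binomial formula into the recursion that the induction on the order needs.
\<close>

lemma fin_diff_Suc:
  "fin_diff (Suc M) h f x = fin_diff M h f (x + h) - fin_diff M h f x"
proof -
  define F where "F j = f (x + real j *\<^sub>R h)" for j
  have "fin_diff (Suc M) h f x = (\<Sum>j\<le>Suc M. (-1) ^ (Suc M - j) * real (Suc M choose j) * F j)"
    by (simp add: fin_diff_def F_def)
  also have "\<dots> = (-1) ^ Suc M * F 0 + (\<Sum>j\<le>M. (-1) ^ (M - j) * real (Suc M choose Suc j) * F (Suc j))"
    by (subst sum.atMost_Suc_shift) simp
  also have "(\<Sum>j\<le>M. (-1) ^ (M - j) * real (Suc M choose Suc j) * F (Suc j)) =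
     (\<Sum>j\<le>M. (-1) ^ (M - j) * real (M choose j) * F (Suc j)) +
     (\<Sum>j\<le>M. (-1) ^ (M - j) * real (M choose Suc j) * F (Suc j))"
    by (simp add: sum.distrib[symmetric] algebra_simps)
  also have "(\<Sum>j\<le>M. (-1) ^ (M - j) * real (M choose Suc j) * F (Suc j)) =
      (\<Sum>j\<in>{..<M}. (-1) ^ (M - j) * real (M choose Suc j) * F (Suc j))"
    by (rule sum.mono_neutral_right) (auto simp: not_less binomial_eq_0)
  also have "\<dots> = - (\<Sum>j\<in>{..<M}. (-1) ^ (M - Suc j) * real (M choose Suc j) * F (Suc j))"
    unfolding sum_negf[symmetric]
  proof (intro sum.cong refl)
    fix j assume "j \<in> {..<M}"
    then have "M - j = Suc (M - Suc j)" by auto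
    then show "(-1) ^ (M - j) * real (M choose Suc j) * F (Suc j) =
        - ((-1) ^ (M - Suc j) * real (M choose Suc j) * F (Suc j))" by simp
  qed
  also have "(-1) ^ Suc M * F 0 + ((\<Sum>j\<le>M. (-1) ^ (M - j) * real (M choose j) * F (Suc j)) +
      - (\<Sum>j\<in>{..<M}. (-1) ^ (M - Suc j) * real (M choose Suc j) * F (Suc j))) =
     (\<Sum>j\<le>M. (-1) ^ (M - j) * real (M choose j) * F (Suc j)) -
     ((-1) ^ M * F 0 + (\<Sum>j\<in>{..<M}. (-1) ^ (M - Suc j) * real (M choose Suc j) * F (Suc j)))"
    by simp
  also have "(-1) ^ M * F 0 + (\<Sum>j\<in>{..<M}. (-1) ^ (M - Suc j) * real (M choose Suc j) * F (Suc j))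
     = (\<Sum>j\<le>M. (-1) ^ (M - j) * real (M choose j) * F j)"
    by (subst sum.atMost_shift) simp
  also have "(\<Sum>j\<le>M. (-1) ^ (M - j) * real (M choose j) * F (Suc j)) = fin_diff M h f (x + h)"
    by (simp add: fin_diff_def F_def algebra_simps)
  finally show ?thesis by (simp add: fin_diff_def F_def)
qed

lemma fin_diff_0: "fin_diff 0 h f x = f x"
  by (simp add: fin_diff_def)

lemma fin_diff_bounded:
  assumes "\<And>z. \<bar>f z\<bar> \<le> 1"
  shows "\<bar>fin_diff M h f x\<bar> \<le> 2 ^ M"
proof -
  have "\<bar>fin_diff M h f x\<bar> \<le> (\<Sum>j\<le>M. real (M choose j))"
    unfolding fin_diff_def
    by (rule order_trans[OF sum_abs sum_mono])
       (use assms in \<open>simp add: abs_mult mult_left_le\<close>)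
  also have "\<dots> = 2 ^ M" using choose_row_sum[of M] by (simp flip: of_nat_sum)
  finally show ?thesis .
qed

text \<open>
  The polynomial cut-off has \<open>k - 1\<close> continuous derivatives, which is all the smoothness that
  differences of order below \<open>k\<close> can see.
\<close>

definition bump :: "nat \<Rightarrow> 'a::real_inner \<Rightarrow> real" where
  "bump k z = max 0 (1 - z \<bullet> z) ^ k"

text \<open>
  Differentiating a bump along the direction \<open>h\<close> lowers the exponent and produces factors \<open>z \<bullet> h\<close>;
  this family is closed under that derivative.
\<close>

definition moment_bump :: "'a::real_inner \<Rightarrow> nat \<Rightarrow> nat \<Rightarrow> 'a \<Rightarrow> real" where
  "moment_bump h i k z = (z \<bullet> h) ^ i * bump k z"

lemma bump_nonneg: "0 \<le> bump k z" by (simp add: bump_def)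

lemma bump_le_1: "bump k z \<le> 1"
  by (auto simp: bump_def intro!: power_le_one)

lemma bump_eq_0: "0 < k \<Longrightarrow> 1 \<le> norm z \<Longrightarrow> bump k z = 0"
  using one_le_power[of "norm z" 2] by (simp add: bump_def power2_norm_eq_inner[symmetric])

lemma continuous_on_bump: "continuous_on A (bump k)"
  unfolding bump_def by (intro continuous_intros)

lemma max0_power_deriv:
  fixes x :: real
  assumes "2 \<le> k"
  shows "((\<lambda>x. max 0 x ^ k) has_real_derivative real k * max 0 x ^ (k - 1)) (at x)"
proof -
  consider "x < 0" | "x = 0" | "x > 0" by linarith
  then show ?thesis
  proof cases
    case 1
    have "((\<lambda>x::real. 0) has_real_derivative 0) (at x)" by simp
    then have "((\<lambda>x. max 0 x ^ k) has_real_derivative 0) (at x)"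
      by (rule has_field_derivative_transform_within_open[of _ _ _ "{..<0}"])
         (use 1 assms in auto)
    then show ?thesis using 1 assms by (simp add: power_0_left)
  next
    case 3
    have "((\<lambda>x::real. x ^ k) has_real_derivative real k * x ^ (k - 1)) (at x)"
      by (auto intro!: derivative_eq_intros)
    then have "((\<lambda>x. max 0 x ^ k) has_real_derivative real k * x ^ (k - 1)) (at x)"
      by (rule has_field_derivative_transform_within_open[of _ _ _ "{0<..}"])
         (use 3 in auto)
    then show ?thesis using 3 by simp
  next
    case 2
    have "((\<lambda>h::real. (max 0 h ^ k - 0) / h) \<longlongrightarrow> 0) (at 0)"
    proof (rule Lim_null_comparison)
      have "norm ((max 0 h ^ k - 0) / h) \<le> \<bar>h\<bar>" if "\<bar>h\<bar> < 1" for h :: real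
      proof (cases "h > 0")
        case True
        have "h ^ k / h = h ^ (k - 1)" using True assms by (simp add: power_diff)
        also have "\<dots> \<le> h ^ 1" using True that assms by (intro power_decreasing) auto
        finally show ?thesis using True by simp
      qed (use assms in \<open>auto simp: power_0_left\<close>)
      then show "\<forall>\<^sub>F h::real in at 0. norm ((max 0 h ^ k - 0) / h) \<le> \<bar>h\<bar>"
        unfolding eventually_at by (intro exI[of _ 1]) (auto simp: dist_real_def)
      show "((\<lambda>h::real. \<bar>h\<bar>) \<longlongrightarrow> 0) (at 0)"
        using tendsto_rabs[OF tendsto_ident_at[of "0::real"]] by simp
    qed
    then show ?thesis using 2 assms by (simp add: DERIV_def power_0_left)
  qed
qed

text \<open>
  For \<open>i = 0\<close> the first summand vanishes, whatever \<open>i - 1\<close> stands for.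
\<close>

lemma moment_bump_deriv:
  assumes "2 \<le> k"
  shows "((\<lambda>t. moment_bump h i k (z + t *\<^sub>R h)) has_real_derivative
     real i * (h \<bullet> h) * moment_bump h (i - 1) k (z + t *\<^sub>R h)
     - 2 * real k * moment_bump h (Suc i) (k - 1) (z + t *\<^sub>R h)) (at t)"
proof -
  have 1: "((\<lambda>t. (z + t *\<^sub>R h) \<bullet> h) has_real_derivative h \<bullet> h) (at t)" for t
    by (auto simp: inner_add_left intro!: derivative_eq_intros)
  have 2: "((\<lambda>t. 1 - (z + t *\<^sub>R h) \<bullet> (z + t *\<^sub>R h)) has_real_derivative
      - 2 * ((z + t *\<^sub>R h) \<bullet> h)) (at t)" for t
    by (auto simp: inner_add_left inner_add_right inner_commute algebra_simps
             intro!: derivative_eq_intros)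
  have 3: "((\<lambda>t. bump k (z + t *\<^sub>R h)) has_real_derivative
      real k * bump (k - 1) (z + t *\<^sub>R h) * (- 2 * ((z + t *\<^sub>R h) \<bullet> h))) (at t)"
    unfolding bump_def by (rule DERIV_chain2[OF max0_power_deriv[OF assms] 2])
  show ?thesis
    unfolding moment_bump_def
    by (rule derivative_eq_intros 1 3 refl)+ (simp add: algebra_simps)
qed

lemma fin_diff_lin:
  "fin_diff M h (\<lambda>z. a * f z - b * g z) x = a * fin_diff M h f x - b * fin_diff M h g x"
  by (simp add: fin_diff_def sum_distrib_left sum_subtractf[symmetric] algebra_simps)

lemma fin_diff_deriv:
  assumes "\<And>z t. ((\<lambda>t. f (z + t *\<^sub>R h)) has_real_derivative g (z + t *\<^sub>R h)) (at t)"
  shows "((\<lambda>t. fin_diff M h f (z + t *\<^sub>R h)) has_real_derivative fin_diff M h g (z + t *\<^sub>R h)) (at t)"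
proof -
  have "((\<lambda>t. f (z + t *\<^sub>R h + real j *\<^sub>R h)) has_real_derivative
          g (z + t *\<^sub>R h + real j *\<^sub>R h)) (at t)" for j t
    using assms[of "z + real j *\<^sub>R h" t] by (simp add: algebra_simps)
  then show ?thesis
    unfolding fin_diff_def by (auto intro!: derivative_eq_intros simp: mult.commute)
qed

text \<open>
  Induction on the order of the difference: by the mean value theorem one difference costs one
  derivative in direction \<open>h\<close>, and each derivative gains one factor \<open>norm h\<close>, either from \<open>h \<bullet> h\<close>
  in exchange for a factor \<open>z \<bullet> h\<close> or from an additional factor \<open>z \<bullet> h\<close>.
\<close>

lemma fin_diff_moment_bump:
  assumes "k < K"
  shows "\<exists>C\<ge>0. \<forall>(h::'a::euclidean_space) z. \<bar>fin_diff k h (moment_bump h i K) z\<bar> \<le> C * norm h ^ (i + k)"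
  using assms
proof (induction k arbitrary: i K)
  case 0
  have "\<bar>moment_bump h i K z\<bar> \<le> norm h ^ i" for h z :: 'a
  proof (cases "norm z < 1")
    case True
    have "\<bar>z \<bullet> h\<bar> \<le> norm z * norm h" by (rule Cauchy_Schwarz_ineq2)
    also have "\<dots> \<le> 1 * norm h" using True by (intro mult_right_mono) auto
    finally have "\<bar>z \<bullet> h\<bar> ^ i * bump K z \<le> norm h ^ i * 1"
      by (intro mult_mono power_mono bump_le_1) (auto simp: bump_nonneg)
    then show ?thesis by (simp add: moment_bump_def abs_mult power_abs bump_nonneg)
  next
    case False
    then show ?thesis using 0 by (simp add: moment_bump_def bump_eq_0)
  qed
  then show ?case by (intro exI[of _ 1]) (auto simp: fin_diff_0)
next
  case (Suc k)
  have k: "k < K" "k < K - 1" using Suc.prems by auto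
  from Suc.IH[OF k(1), of "i - 1"] obtain C1 where C1: "C1 \<ge> 0"
    "\<And>h z::'a. \<bar>fin_diff k h (moment_bump h (i - 1) K) z\<bar> \<le> C1 * norm h ^ (i - 1 + k)" by blast
  from Suc.IH[OF k(2), of "Suc i"] obtain C2 where C2: "C2 \<ge> 0"
    "\<And>h z::'a. \<bar>fin_diff k h (moment_bump h (Suc i) (K - 1)) z\<bar> \<le> C2 * norm h ^ (Suc i + k)" by blast
  define C where "C = real i * C1 + 2 * real K * C2"
  have "\<bar>fin_diff (Suc k) h (moment_bump h i K) z\<bar> \<le> C * norm h ^ (i + Suc k)" for h z :: 'a
  proof -
    let ?g = "\<lambda>z. (real i * (h \<bullet> h)) * moment_bump h (i - 1) K z
                  - (2 * real K) * moment_bump h (Suc i) (K - 1) z"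
    let ?\<phi> = "\<lambda>t. fin_diff k h (moment_bump h i K) (z + t *\<^sub>R h)"
    have D: "(?\<phi> has_real_derivative fin_diff k h ?g (z + t *\<^sub>R h)) (at t)" for t
      by (rule fin_diff_deriv, rule moment_bump_deriv) (use Suc.prems in auto)
    have b: "\<bar>fin_diff k h ?g w\<bar> \<le> C * norm h ^ (i + Suc k)" for w
    proof -
      have "\<bar>real i * (h \<bullet> h) * fin_diff k h (moment_bump h (i - 1) K) w\<bar>
          \<le> real i * (h \<bullet> h) * (C1 * norm h ^ (i - 1 + k))"
        unfolding abs_mult using C1(2)[of h w] by (auto intro!: mult_left_mono)
      also have "\<dots> = real i * C1 * norm h ^ (i + Suc k)"
      proof (cases i)
        case (Suc i')
        then show ?thesis by (simp add: power2_norm_eq_inner[symmetric] power2_eq_square)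
      qed simp
      finally have 1: "\<bar>real i * (h \<bullet> h) * fin_diff k h (moment_bump h (i - 1) K) w\<bar>
          \<le> real i * C1 * norm h ^ (i + Suc k)" .
      have 2: "\<bar>2 * real K * fin_diff k h (moment_bump h (Suc i) (K - 1)) w\<bar>
          \<le> 2 * real K * (C2 * norm h ^ (i + Suc k))"
        unfolding abs_mult using C2(2)[of h w] by (auto intro!: mult_left_mono)
      show ?thesis unfolding fin_diff_lin C_def distrib_right using 1 2
        by (simp only: abs_le_iff mult.assoc) linarith
    qed
    obtain t where "?\<phi> 1 - ?\<phi> 0 = (1 - 0) * fin_diff k h ?g (z + t *\<^sub>R h)"
      using MVT2[of 0 1 ?\<phi> "\<lambda>t. fin_diff k h ?g (z + t *\<^sub>R h)"] D by auto
    then have "fin_diff (Suc k) h (moment_bump h i K) z = fin_diff k h ?g (z + t *\<^sub>R h)"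
      by (simp add: fin_diff_Suc)
    then show ?thesis using b by simp
  qed
  moreover have "C \<ge> 0" using C1(1) C2(1) by (simp add: C_def)
  ultimately show ?case by blast
qed

text \<open>
  The form used later: smoothness for short \<open>h\<close>, boundedness for long \<open>h\<close>.
\<close>

lemma fin_diff_bump:
  assumes "k < K"
  shows "\<exists>C>0. \<forall>(h::'a::euclidean_space) z. \<bar>fin_diff k h (bump K) z\<bar> \<le> C * min 1 (norm h) ^ k"
proof -
  obtain C where C: "C \<ge> 0" "\<And>h z::'a. \<bar>fin_diff k h (moment_bump h 0 K) z\<bar> \<le> C * norm h ^ (0 + k)"
    using fin_diff_moment_bump[OF assms, of 0] by blast
  have [simp]: "moment_bump h 0 K = bump K" for h :: 'a by (auto simp: moment_bump_def)
  have "\<bar>fin_diff k h (bump K) z\<bar> \<le> (C + 2 ^ k) * min 1 (norm h) ^ k" for h z :: 'a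
  proof (cases "norm h \<le> 1")
    case True
    have "C * norm h ^ k \<le> (C + 2 ^ k) * norm h ^ k" by (intro mult_right_mono) auto
    then show ?thesis using C(2)[of h z] True by (simp add: min_absorb2)
  next
    case False
    have "\<bar>fin_diff k h (bump K) z\<bar> \<le> 2 ^ k"
      by (rule fin_diff_bounded) (simp add: bump_nonneg bump_le_1)
    then show ?thesis using False C(1) by (simp add: min_def)
  qed
  moreover have "C + 2 ^ k > 0" using C(1) by (simp add: add_nonneg_pos)
  ultimately show ?thesis by blast
qed

section \<open>A discrete Young inequality\<close>

text \<open>
  The distance of two levels; one of the two truncated differences is \<open>0\<close>.
\<close>

definition gap :: "nat \<Rightarrow> nat \<Rightarrow> nat" where
  "gap n l = (n - l) + (l - n)"

lemma gap_commute: "gap n l = gap l n"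
  by (simp add: gap_def)

lemma geometric_partial_sum_le:
  fixes r :: real
  assumes "0 \<le> r" "r < 1"
  shows "(\<Sum>k<n. r ^ k) \<le> 1 / (1 - r)"
proof -
  have "(\<Sum>k<n. r ^ k) \<le> (\<Sum>k. r ^ k)"
    by (rule sum_le_suminf) (use assms in auto)
  also have "\<dots> = 1 / (1 - r)" using assms by (intro suminf_geometric) auto
  finally show ?thesis .
qed

lemma sum_power_gap_le:
  fixes r :: real
  assumes "0 < r" "r < 1"
  shows "(\<Sum>n<N. r ^ gap n l) \<le> 2 / (1 - r)"
proof -
  have "(\<Sum>n<N. r ^ gap n l) \<le> (\<Sum>n\<in>{..<l} \<union> {l..<l + N}. r ^ gap n l)"
    by (rule sum_mono2) (use assms in auto)
  also have "\<dots> = (\<Sum>n<l. r ^ gap n l) + (\<Sum>n\<in>{l..<l + N}. r ^ gap n l)"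
    by (rule sum.union_disjoint) auto
  also have "(\<Sum>n<l. r ^ gap n l) \<le> (\<Sum>n<l. r ^ (l - Suc n))"
    by (rule sum_mono) (use assms in \<open>auto simp: gap_def intro!: power_decreasing\<close>)
  also have "\<dots> = (\<Sum>n<l. r ^ n)" by (rule sum.nat_diff_reindex)
  also have "\<dots> \<le> 1 / (1 - r)" using assms by (intro geometric_partial_sum_le) auto
  also have "(\<Sum>n\<in>{l..<l + N}. r ^ gap n l) = (\<Sum>n<N. r ^ n)"
    by (rule sum.reindex_bij_witness[of _ "\<lambda>k. k + l" "\<lambda>n. n - l"]) (auto simp: gap_def)
  also have "\<dots> \<le> 1 / (1 - r)" using assms by (intro geometric_partial_sum_le) auto
  finally show ?thesis by simp
qed

lemma summable_power_gap:
  fixes r :: real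
  assumes "0 < r" "r < 1"
  shows "summable (\<lambda>n. r ^ gap n l)" "(\<Sum>n. r ^ gap n l) \<le> 2 / (1 - r)"
proof -
  show "summable (\<lambda>n. r ^ gap n l)"
    by (rule summableI_nonneg_bounded[OF _ sum_power_gap_le[OF assms]]) (use assms in auto)
  then show "(\<Sum>n. r ^ gap n l) \<le> 2 / (1 - r)"
    by (intro suminf_le_const sum_power_gap_le assms)
qed

definition gap_conv :: "(nat \<Rightarrow> real) \<Rightarrow> real \<Rightarrow> nat \<Rightarrow> real" where
  "gap_conv a r l = (\<Sum>n. a n * r ^ gap n l)"

lemma summable_gap_conv:
  fixes r :: real
  assumes "0 < r" "r < 1" "\<And>n. 0 \<le> a n" "\<And>n. a n \<le> A"
  shows "summable (\<lambda>n. a n * r ^ gap n l)" "gap_conv a r l \<le> A * (2 / (1 - r))"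
proof -
  have 1: "a n * r ^ gap n l \<le> A * r ^ gap n l" for n
    using assms by (intro mult_right_mono) auto
  have 2: "summable (\<lambda>n. A * r ^ gap n l)"
    by (intro summable_mult summable_power_gap assms)
  show 3: "summable (\<lambda>n. a n * r ^ gap n l)"
    by (rule summable_comparison_test'[OF 2, of 0]) (use 1 assms in auto)
  have "gap_conv a r l \<le> (\<Sum>n. A * r ^ gap n l)"
    unfolding gap_conv_def by (rule suminf_le[OF 1 3 2])
  also have "\<dots> = A * (\<Sum>n. r ^ gap n l)"
    by (intro suminf_mult summable_power_gap assms)
  also have "\<dots> \<le> A * (2 / (1 - r))"
    using assms(3,4)[of 0] by (intro mult_left_mono summable_power_gap(2) assms) auto
  finally show "gap_conv a r l \<le> A * (2 / (1 - r))" .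
qed

lemma gap_conv_nonneg:
  assumes "0 < r" "r < 1" "\<And>n. 0 \<le> a n" "\<And>n. a n \<le> A"
  shows "0 \<le> gap_conv a r l"
  unfolding gap_conv_def by (rule suminf_nonneg[OF summable_gap_conv(1)[OF assms]]) (use assms in auto)

lemma summable_powr_imp_bounded:
  fixes a :: "nat \<Rightarrow> real"
  assumes "summable (\<lambda>n. a n powr u)" "\<And>n. 0 \<le> a n" "0 < u"
  obtains A where "0 \<le> A" "\<And>n. a n \<le> A"
proof
  let ?S = "\<Sum>n. a n powr u"
  show "0 \<le> ?S powr (1 / u)" by simp
  fix n
  have "a n powr u \<le> ?S"
    using sum_le_suminf[OF assms(1), of "{n}"] by auto
  then have "(a n powr u) powr (1 / u) \<le> ?S powr (1 / u)"
    using assms by (intro powr_mono2) auto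
  then show "a n \<le> ?S powr (1 / u)" using assms by (simp add: powr_powr)
qed

text \<open>
  This is Young's inequality for the convolution of an \<open>\<ell>\<^sup>u\<close> sequence with a two-sided geometric
  kernel.  Split the kernel as \<open>r = \<rho> * \<rho>\<close>: one half of it is summed directly, while with the other
  half each term is at most the \<open>u\<close>-th root of \<open>S l = (\<Sum>n. (a n * \<rho> ^ gap n l) powr u)\<close>.  Hence the \<open>u\<close>-th power of
  the convolution is at most a multiple of \<open>S l\<close>, and \<open>S\<close> is summable by exchanging sums.
\<close>

lemma summable_gap_conv_powr:
  fixes r :: real
  assumes r: "0 < r" "r < 1" and a: "\<And>n. 0 \<le> a n" and u: "0 < u"
    and sum: "summable (\<lambda>n. a n powr u)"
  shows "summable (\<lambda>l. gap_conv a r l powr u)"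
proof -
  obtain A where A: "0 \<le> A" "\<And>n. a n \<le> A"
    using summable_powr_imp_bounded[OF sum a u] by blast
  define \<rho> where "\<rho> = sqrt r"
  define w where "w = \<rho> powr u"
  have \<rho>: "0 < \<rho>" "\<rho> < 1" "\<rho> * \<rho> = r" using r by (auto simp: \<rho>_def)
  have w: "0 < w" "w < 1" using \<rho> u powr_less_mono2[of u \<rho> 1] by (auto simp: w_def)
  define D where "D = 2 / (1 - \<rho>)"
  have D: "0 \<le> D" using \<rho> by (simp add: D_def)
  define S where "S l = gap_conv (\<lambda>n. a n powr u) w l" for l
  have au: "a n powr u \<le> A powr u" for n using A a u by (intro powr_mono2) auto
  have sS: "summable (\<lambda>n. a n powr u * w ^ gap n l)" for l
    using summable_gap_conv(1)[OF w _ au] by simp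
  have S0: "0 \<le> S l" for l
    unfolding S_def using gap_conv_nonneg[OF w _ au] by simp
  have bound: "gap_conv a r l powr u \<le> D powr u * S l" for l
  proof -
    have 1: "a n * \<rho> ^ gap n l \<le> S l powr (1 / u)" for n
    proof -
      have "(a n * \<rho> ^ gap n l) powr u = a n powr u * w ^ gap n l"
        using \<rho> a by (simp add: powr_mult w_def powr_powr mult.commute flip: powr_realpow)
      also have "\<dots> \<le> S l"
        unfolding S_def gap_conv_def
        using sum_le_suminf[OF sS, of "{n}" l] w by auto
      finally have "((a n * \<rho> ^ gap n l) powr u) powr (1 / u) \<le> S l powr (1 / u)"
        using u by (intro powr_mono2) auto
      then show ?thesis using u a \<rho> by (simp add: powr_powr)
    qed
    have 2: "summable (\<lambda>n. S l powr (1 / u) * \<rho> ^ gap n l)"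
      by (intro summable_mult summable_power_gap \<rho>)
    have "gap_conv a r l \<le> (\<Sum>n. S l powr (1 / u) * \<rho> ^ gap n l)"
      unfolding gap_conv_def
    proof (rule suminf_le[OF _ _ 2])
      show "summable (\<lambda>n. a n * r ^ gap n l)" by (rule summable_gap_conv[OF r a A(2)])
      show "a n * r ^ gap n l \<le> S l powr (1 / u) * \<rho> ^ gap n l" for n
        using mult_right_mono[OF 1[of n], of "\<rho> ^ gap n l"] \<rho>
        by (simp add: power_mult_distrib algebra_simps flip: \<rho>(3))
    qed
    also have "\<dots> = S l powr (1 / u) * (\<Sum>n. \<rho> ^ gap n l)"
      by (intro suminf_mult summable_power_gap \<rho>)
    also have "\<dots> \<le> S l powr (1 / u) * D"
      unfolding D_def by (intro mult_left_mono summable_power_gap \<rho>) auto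
    finally have "gap_conv a r l powr u \<le> (S l powr (1 / u) * D) powr u"
      using u gap_conv_nonneg[OF r a A(2)] by (intro powr_mono2) auto
    also have "\<dots> = D powr u * S l"
      using u D S0[of l] by (simp add: powr_mult powr_powr mult.commute)
    finally show ?thesis .
  qed
  have "summable S"
  proof (rule summableI_nonneg_bounded[OF S0])
    fix L
    have "(\<Sum>l<L. S l) = (\<Sum>n. \<Sum>l<L. a n powr u * w ^ gap n l)"
      unfolding S_def gap_conv_def by (rule suminf_sum[symmetric]) (rule sS)
    also have "\<dots> \<le> (\<Sum>n. a n powr u * (2 / (1 - w)))"
    proof (rule suminf_le)
      show "(\<Sum>l<L. a n powr u * w ^ gap n l) \<le> a n powr u * (2 / (1 - w))" for n
        unfolding sum_distrib_left[symmetric] gap_commute[of n]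
        by (intro mult_left_mono sum_power_gap_le w) auto
    qed (intro summable_sum sS summable_mult2 sum)+
    finally show "(\<Sum>l<L. S l) \<le> (\<Sum>n. a n powr u * (2 / (1 - w)))" .
  qed
  then have "summable (\<lambda>l. D powr u * S l)" by (rule summable_mult)
  then show ?thesis
    by (rule summable_comparison_test'[of _ 0]) (use bound in auto)
qed

section \<open>Sums of well separated spikes and their Besov norm\<close>

text \<open>
  At level \<open>n\<close> there are \<open>count n\<close> spikes of radius \<open>(1/2) ^ n\<close>, whose second components are centred at
  \<open>ctr n v\<close> with \<open>v < count n\<close>.  All spikes are enumerated by \<open>i = prod_encode (n, v)\<close>, and the first
  components of their centres are placed on the line through \<open>e\<close> at distance \<open>separation\<close>; the
  codes \<open>i\<close> with \<open>v \<ge> count n\<close> get height \<open>0\<close>.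
\<close>

locale spikes =
  fixes p s :: real and M :: nat and lam :: "nat \<Rightarrow> real" and count :: "nat \<Rightarrow> nat"
    and ctr :: "nat \<Rightarrow> nat \<Rightarrow> 'b::euclidean_space" and e :: "'a::euclidean_space"
  assumes p_pos: "0 < p" and s_pos: "0 < s" and s_less: "s < real M"
    and lam_nonneg: "\<And>n. 0 \<le> lam n" and norm_e: "norm e = 1"
begin

definition amplitude :: "nat \<Rightarrow> real" where
  "amplitude n = lam n * 2 powr (real n * (real DIM('a) / p - s))"

text \<open>
  The shifts \<open>z + j *\<^sub>R h\<close> of a difference of order at most \<open>M\<close> with \<open>norm h \<le> 1\<close> stay within
  distance \<open>M\<close> of \<open>z\<close>, and spikes have radius at most \<open>1\<close>.  With this separation all these shifts
  meet at most one spike.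
\<close>

definition separation :: real where
  "separation = 4 * real (M + 1)"

definition pos :: "nat \<Rightarrow> 'a" where
  "pos i = (separation * real i) *\<^sub>R e"

definition level :: "nat \<Rightarrow> nat" where
  "level i = fst (prod_decode i)"

definition centre :: "nat \<Rightarrow> 'a \<times> 'b" where
  "centre i = (pos i, ctr (level i) (snd (prod_decode i)))"

definition height :: "nat \<Rightarrow> real" where
  "height i = (if snd (prod_decode i) < count (level i) then amplitude (level i) else 0)"

definition spike :: "nat \<Rightarrow> 'a \<times> 'b \<Rightarrow> real" where
  "spike i z = height i * bump (M + 1) (2 ^ level i *\<^sub>R (z - centre i))"

definition spike_sum :: "'a \<times> 'b \<Rightarrow> real" where
  "spike_sum z = (\<Sum>i. spike i z)"

text \<open>
  Up to constants, the contribution of level \<open>n\<close> to the \<open>p\<close>-th power of the Besov quasi-norm.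
\<close>

definition mass :: "nat \<Rightarrow> real" where
  "mass n = real (count n) * lam n powr p * 2 powr (- (real n * real DIM('b)))"

lemma amplitude_nonneg: "0 \<le> amplitude n"
  by (simp add: amplitude_def lam_nonneg)

lemma height_nonneg: "0 \<le> height i"
  by (simp add: height_def amplitude_nonneg)

lemma mass_nonneg: "0 \<le> mass n"
  by (simp add: mass_def)

lemma spike_eq_0:
  assumes "(1/2) ^ level i \<le> norm (z - centre i)"
  shows "spike i z = 0"
proof -
  have "2 ^ level i * (1/2) ^ level i \<le> 2 ^ level i * norm (z - centre i)"
    using assms by (intro mult_left_mono) auto
  then have "1 \<le> norm (2 ^ level i *\<^sub>R (z - centre i))"
    by (simp add: power_mult_distrib[symmetric])
  then show ?thesis unfolding spike_def by (subst bump_eq_0) auto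
qed

lemma spike_eq_0_far:
  assumes "1 \<le> norm (fst z - pos i)"
  shows "spike i z = 0"
proof (rule spike_eq_0)
  have "(1/2::real) ^ level i \<le> 1" by (rule power_le_one) auto
  also have "1 \<le> norm (fst (z - centre i))" using assms by (simp add: centre_def)
  also have "\<dots> \<le> norm (z - centre i)" using norm_fst_le[of "fst (z - centre i)" "snd (z - centre i)"]
    by (simp only: prod.collapse)
  finally show "(1/2) ^ level i \<le> norm (z - centre i)" .
qed

lemma pos_separated:
  assumes "norm (x - pos i) \<le> real (2 * M + 1)" "i' \<noteq> i"
  shows "1 \<le> norm (x - pos i')"
proof -
  have "pos i - pos i' = (separation * (real i - real i')) *\<^sub>R e"
    by (simp add: pos_def algebra_simps)
  then have "norm (pos i - pos i') = separation * \<bar>real i - real i'\<bar>"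
    by (simp add: norm_e abs_mult separation_def)
  also have "\<dots> \<ge> separation * 1" using assms(2) by (intro mult_left_mono) (auto simp: separation_def)
  finally have "separation \<le> norm (pos i - pos i')" by simp
  also have "\<dots> \<le> norm (x - pos i) + norm (x - pos i')"
    using norm_triangle_ineq4[of "x - pos i'" "x - pos i"] by (simp add: norm_minus_commute)
  finally show ?thesis using assms(1) by (simp add: separation_def)
qed

lemma spike_sum_near:
  assumes "norm (fst z - pos i) \<le> real (2 * M + 1)"
  shows "spike_sum z = spike i z"
proof -
  have "spike i' z = 0" if "i' \<noteq> i" for i'
    by (rule spike_eq_0_far, rule pos_separated[OF assms that])
  then show ?thesis
    unfolding spike_sum_def by (subst suminf_finite[of "{i}"]) auto
qed

lemma spike_sum_far:
  assumes "\<And>i. 1 \<le> norm (fst z - pos i)"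
  shows "spike_sum z = 0"
  unfolding spike_sum_def using spike_eq_0_far[OF assms] by simp

lemma borel_measurable_spike [measurable]: "spike i \<in> borel_measurable borel"
  unfolding spike_def
  by (intro borel_measurable_continuous_onI continuous_intros
        continuous_on_compose2[OF continuous_on_bump[of UNIV]]) auto

lemma borel_measurable_spike_sum [measurable]: "spike_sum \<in> borel_measurable borel"
  unfolding spike_sum_def by measurable

text \<open>
  At most one term of the series is nonzero, since all points \<open>z + j *\<^sub>R h\<close> see the same spike.
\<close>

lemma fin_diff_spike_sum_le:
  assumes "norm h \<le> 1" "k \<le> M"
  shows "ennreal (\<bar>fin_diff k h spike_sum z\<bar> powr p) \<le> (\<Sum>i. ennreal (\<bar>fin_diff k h (spike i) z\<bar> powr p))"
proof (cases "\<exists>i. norm (fst z - pos i) < real (M + 1)")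
  case True
  then obtain i where i: "norm (fst z - pos i) < real (M + 1)" by blast
  have "spike_sum (z + real j *\<^sub>R h) = spike i (z + real j *\<^sub>R h)" if "j \<le> k" for j
  proof (rule spike_sum_near)
    have "norm (fst h) \<le> 1" using assms(1) norm_fst_le[of "fst h" "snd h"] by simp
    then have "norm (real j *\<^sub>R fst h) \<le> real M * 1"
      using that assms(2) unfolding norm_scaleR by (intro mult_mono) auto
    moreover have "norm (fst (z + real j *\<^sub>R h) - pos i) \<le> norm (fst z - pos i) + norm (real j *\<^sub>R fst h)"
      using norm_triangle_ineq[of "fst z - pos i" "real j *\<^sub>R fst h"] by (simp add: algebra_simps)
    ultimately show "norm (fst (z + real j *\<^sub>R h) - pos i) \<le> real (2 * M + 1)"
      using i by simp
  qed
  then have eq: "fin_diff k h spike_sum z = fin_diff k h (spike i) z"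
    unfolding fin_diff_def by (intro sum.cong refl) (simp only: atMost_iff)
  have "(\<Sum>i\<in>{i}. ennreal (\<bar>fin_diff k h (spike i) z\<bar> powr p)) \<le>
      (\<Sum>i. ennreal (\<bar>fin_diff k h (spike i) z\<bar> powr p))"
    by (rule sum_le_suminf) auto
  then show ?thesis unfolding eq by (simp only: sum.insert_if sum.empty finite.emptyI empty_iff if_False add_0_right)
next
  case False
  have "spike_sum (z + real j *\<^sub>R h) = 0" if "j \<le> k" for j
  proof (rule spike_sum_far)
    fix i
    have "norm (fst h) \<le> 1" using assms(1) norm_fst_le[of "fst h" "snd h"] by simp
    then have "norm (real j *\<^sub>R fst h) \<le> real M * 1"
      using that assms(2) unfolding norm_scaleR by (intro mult_mono) auto
    moreover have "norm (fst z - pos i) \<le> norm (fst (z + real j *\<^sub>R h) - pos i) + norm (real j *\<^sub>R fst h)"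
      using norm_triangle_ineq4[of "fst (z + real j *\<^sub>R h) - pos i" "real j *\<^sub>R fst h"] by (simp add: algebra_simps)
    moreover have "real (M + 1) \<le> norm (fst z - pos i)" using False by (auto simp: not_less)
    ultimately show "1 \<le> norm (fst (z + real j *\<^sub>R h) - pos i)" by simp
  qed
  then have "fin_diff k h spike_sum z = 0"
    unfolding fin_diff_def by (intro sum.neutral) auto
  then show ?thesis by simp
qed

lemma fin_diff_spike:
  "fin_diff k h (spike i) z =
     height i * fin_diff k (2 ^ level i *\<^sub>R h) (bump (M + 1)) (2 ^ level i *\<^sub>R (z - centre i))"
  unfolding fin_diff_def spike_def sum_distrib_left
  by (intro sum.cong refl) (simp add: algebra_simps)

text \<open>
  The difference is supported in \<open>k + 1\<close> balls of the radius of the spike, one for each shift, and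
  \<open>fin_diff_bump\<close> bounds it there after rescaling.
\<close>

lemma nn_integral_fin_diff_spike_le:
  assumes C: "\<And>h z. \<bar>fin_diff k h (bump (M + 1)) (z::'a \<times> 'b)\<bar> \<le> C * min 1 (norm h) ^ k" "0 < C"
  shows "(\<integral>\<^sup>+z. ennreal (\<bar>fin_diff k h (spike i) z\<bar> powr p) \<partial>lebesgue) \<le>
      ennreal ((C * height i * min 1 (2 ^ level i * norm h) ^ k) powr p *
        (real (k + 1) * (unit_ball_vol (real DIM('a \<times> 'b)) * ((1/2) ^ level i) ^ DIM('a \<times> 'b))))"
proof -
  let ?r = "(1/2::real) ^ level i"
  let ?B = "(C * height i * min 1 (2 ^ level i * norm h) ^ k) powr p"
  define U where "U = (\<Union>j\<le>k. cball (centre i - real j *\<^sub>R h) ?r)"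
  have [measurable]: "U \<in> sets borel" unfolding U_def by auto
  have le: "ennreal (\<bar>fin_diff k h (spike i) z\<bar> powr p) \<le> ennreal ?B * indicator U z" for z
  proof (cases "z \<in> U")
    case True
    have "\<bar>fin_diff k h (spike i) z\<bar> \<le> height i * (C * min 1 (norm (2 ^ level i *\<^sub>R h)) ^ k)"
      unfolding fin_diff_spike abs_mult abs_of_nonneg[OF height_nonneg]
      by (rule mult_left_mono[OF C(1) height_nonneg])
    then have "\<bar>fin_diff k h (spike i) z\<bar> \<le> C * height i * min 1 (2 ^ level i * norm h) ^ k"
      by (simp add: algebra_simps)
    then have "\<bar>fin_diff k h (spike i) z\<bar> powr p \<le> ?B"
      using p_pos by (intro powr_mono2) auto
    then show ?thesis using True by (simp add: ennreal_leI)
  next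
    case False
    have "spike i (z + real j *\<^sub>R h) = 0" if "j \<le> k" for j
    proof (rule spike_eq_0)
      have "z \<notin> cball (centre i - real j *\<^sub>R h) ?r" using False that by (auto simp: U_def)
      then show "?r \<le> norm (z + real j *\<^sub>R h - centre i)"
        by (simp add: dist_norm norm_minus_commute algebra_simps)
    qed
    then have "fin_diff k h (spike i) z = 0"
      unfolding fin_diff_def by (intro sum.neutral) auto
    then show ?thesis by simp
  qed
  have "(\<integral>\<^sup>+z. ennreal (\<bar>fin_diff k h (spike i) z\<bar> powr p) \<partial>lebesgue) \<le> (\<integral>\<^sup>+z. ennreal ?B * indicator U z \<partial>lebesgue)"
    by (rule nn_integral_mono) (rule le)
  also have "\<dots> = ennreal ?B * emeasure lborel U"
    unfolding nn_integral_completion by (rule nn_integral_cmult_indicator) auto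
  also have "\<dots> \<le> ennreal ?B * ennreal (real (k + 1) * (unit_ball_vol (real DIM('a \<times> 'b)) * ?r ^ DIM('a \<times> 'b)))"
  proof (rule mult_left_mono)
    have "emeasure lborel U \<le> (\<Sum>j\<le>k. emeasure lborel (cball (centre i - real j *\<^sub>R h) ?r))"
      unfolding U_def by (rule emeasure_subadditive_finite) auto
    also have "\<dots> = (\<Sum>j\<le>k. ennreal (unit_ball_vol (real DIM('a \<times> 'b)) * ?r ^ DIM('a \<times> 'b)))"
      by (intro sum.cong refl emeasure_cball) auto
    also have "\<dots> = ennreal (\<Sum>j\<le>k. unit_ball_vol (real DIM('a \<times> 'b)) * ?r ^ DIM('a \<times> 'b))"
      by (rule sum_ennreal) auto
    finally show "emeasure lborel U \<le> ennreal (real (k + 1) * (unit_ball_vol (real DIM('a \<times> 'b)) * ?r ^ DIM('a \<times> 'b)))"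
      by (simp only: sum_constant card_atMost Suc_eq_plus1)
  qed simp
  also have "\<dots> = ennreal (?B * (real (k + 1) * (unit_ball_vol (real DIM('a \<times> 'b)) * ?r ^ DIM('a \<times> 'b))))"
    by (rule ennreal_mult[symmetric]) auto
  finally show ?thesis .
qed

text \<open>
  The damping per level away from the shell \<open>norm h \<approx> (1/2) ^ l\<close>: levels \<open>n > l\<close> decay
  like \<open>2 powr (- s p)\<close>, levels \<open>n < l\<close> like \<open>2 powr (- (M - s) p)\<close>.
\<close>

definition rate :: real where
  "rate = 2 powr (- min (s * p) ((real M - s) * p))"

lemma rate: "0 < rate" "rate < 1"
  using p_pos s_pos s_less powr_less_mono[of "- min (s * p) ((real M - s) * p)" 0 2]
  by (auto simp: rate_def)

text \<open>
  The height was chosen so that the \<open>p\<close>-th power of height times volume splits into the factor that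
  enters \<open>mass\<close> and the factor \<open>2 powr (- n s p)\<close> that belongs to the smoothness \<open>s\<close>.
\<close>

lemma amplitude_powr: "amplitude n powr p * ((1/2) ^ n) ^ DIM('a \<times> 'b) =
    lam n powr p * 2 powr (- (real n * real DIM('b))) * 2 powr (- (real n * s * p))"
proof -
  have "amplitude n powr p = lam n powr p * 2 powr (real n * (real DIM('a) - s * p))"
  proof -
    have "real n * (real DIM('a) / p - s) * p = real n * (real DIM('a) - s * p)"
      using p_pos by (simp add: algebra_simps)
    then show ?thesis unfolding amplitude_def using lam_nonneg by (subst powr_mult) (simp_all only: powr_powr powr_ge_zero)
  qed
  moreover have "((1/2::real) ^ n) ^ DIM('a \<times> 'b) = 2 powr (- (real n * (real DIM('a) + real DIM('b))))"
    unfolding power_mult[symmetric] unfolding half_power_eq_powr by simp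
  ultimately show ?thesis
    by (simp add: mult.assoc powr_add[symmetric] algebra_simps)
qed

lemma nn_integral_fin_diff_spike_sum_le:
  assumes C: "\<And>h z. \<bar>fin_diff k h (bump (M + 1)) (z::'a \<times> 'b)\<bar> \<le> C * min 1 (norm h) ^ k" "0 < C"
    and k: "k \<le> M" and h: "norm h \<le> 1"
  shows "(\<integral>\<^sup>+z. ennreal (\<bar>fin_diff k h spike_sum z\<bar> powr p) \<partial>lebesgue) \<le>
     (\<Sum>n. ennreal (C powr p * real (k + 1) * unit_ball_vol (real DIM('a \<times> 'b)) *
        (mass n * (2 powr (- (real n * s * p)) * (min 1 (2 ^ n * norm h) ^ k) powr p))))"
    (is "_ \<le> (\<Sum>n. ennreal (?t n))")
proof -
  define \<beta> where "\<beta> n = (C * amplitude n * min 1 (2 ^ n * norm h) ^ k) powr p *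
        (real (k + 1) * (unit_ball_vol (real DIM('a \<times> 'b)) * ((1/2) ^ n) ^ DIM('a \<times> 'b)))" for n
  define F where "F = (\<lambda>(n, v). if v < count n then ennreal (\<beta> n) else 0)"
  have meas: "(\<lambda>z. ennreal (\<bar>fin_diff k h (spike i) z\<bar> powr p)) \<in> borel_measurable lborel" for i
    unfolding fin_diff_def by measurable
  have "(\<integral>\<^sup>+z. ennreal (\<bar>fin_diff k h spike_sum z\<bar> powr p) \<partial>lebesgue) \<le>
      (\<integral>\<^sup>+z. (\<Sum>i. ennreal (\<bar>fin_diff k h (spike i) z\<bar> powr p)) \<partial>lebesgue)"
    by (intro nn_integral_mono fin_diff_spike_sum_le h k)
  also have "\<dots> = (\<Sum>i. \<integral>\<^sup>+z. ennreal (\<bar>fin_diff k h (spike i) z\<bar> powr p) \<partial>lebesgue)"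
    unfolding nn_integral_completion using meas by (rule nn_integral_suminf)
  also have "\<dots> \<le> (\<Sum>i. F (prod_decode i))"
  proof (rule suminf_le)
    fix i
    show "(\<integral>\<^sup>+z. ennreal (\<bar>fin_diff k h (spike i) z\<bar> powr p) \<partial>lebesgue) \<le> F (prod_decode i)"
      using nn_integral_fin_diff_spike_le[OF C, of h i] p_pos
      by (simp add: F_def \<beta>_def height_def level_def case_prod_unfold split: if_splits)
  qed auto
  also have "\<dots> = (\<Sum>n. ennreal (?t n))"
  proof (rule suminf_ennreal_2dimen)
    fix n
    have "(\<Sum>v. F (n, v)) = (\<Sum>v<count n. F (n, v))"
      by (rule suminf_finite) (auto simp: F_def)
    also have "\<dots> = of_nat (count n) * ennreal (\<beta> n)" by (simp add: F_def)
    also have "\<dots> = ennreal (real (count n) * \<beta> n)"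
      by (simp add: ennreal_mult' ennreal_of_nat_eq_real_of_nat)
    also have "real (count n) * \<beta> n = ?t n"
    proof -
      have "\<beta> n = C powr p * real (k + 1) * unit_ball_vol (real DIM('a \<times> 'b)) * ((min 1 (2 ^ n * norm h) ^ k) powr p)
          * (amplitude n powr p * ((1/2) ^ n) ^ DIM('a \<times> 'b))"
        using C(2) amplitude_nonneg[of n] by (simp add: \<beta>_def powr_mult del: of_nat_Suc)
      then show ?thesis unfolding amplitude_powr mass_def by (simp only: mult_ac)
    qed
    finally show "ennreal (?t n) = (\<Sum>v. F (n, v))" by simp
  qed
  finally show ?thesis .
qed

lemma fin_diff_power_le_rate:
  "2 powr (- (real n * s * p)) * (min 1 (2 ^ n * (1/2) ^ l) ^ M) powr p
      \<le> 2 powr (- (real l * s * p)) * rate ^ gap n l"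
proof (cases "l \<le> n")
  case True
  have "(2::real) ^ n * (1/2) ^ l = 2 ^ (n - l)"
    using True by (simp add: power_diff power_one_over)
  then have "min 1 ((2::real) ^ n * (1/2) ^ l) = 1" by simp
  then have "2 powr (- (real n * s * p)) * (min 1 (2 ^ n * (1/2) ^ l) ^ M) powr p
      = 2 powr (- (real l * s * p)) * 2 powr (- (real (n - l) * (s * p)))"
    using True by (simp add: powr_add[symmetric] of_nat_diff algebra_simps)
  also have "2 powr (- (real (n - l) * (s * p))) \<le> 2 powr (real (gap n l) * - min (s * p) ((real M - s) * p))"
    using True by (intro powr_mono) (auto simp: gap_def intro!: mult_left_mono)
  also have "\<dots> = rate ^ gap n l"
    unfolding rate_def by (simp add: powr_realpow[symmetric] powr_powr mult.commute)
  finally show ?thesis by simp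
next
  case False
  have "(2::real) ^ n * (1/2) ^ l = (1/2) ^ (l - n)"
    using False by (simp add: power_diff power_one_over)
  moreover have "(1/2::real) ^ (l - n) \<le> 1" by (rule power_le_one) auto
  ultimately have "(min 1 ((2::real) ^ n * (1/2) ^ l) ^ M) powr p = (((1/2) ^ (l - n)) ^ M) powr p"
    by simp
  also have "\<dots> = 2 powr (- (real (l - n) * (real M * p)))"
    unfolding power_mult[symmetric] unfolding half_power_eq_powr by (simp add: powr_powr mult_ac)
  finally have "2 powr (- (real n * s * p)) * (min 1 (2 ^ n * (1/2) ^ l) ^ M) powr p
      = 2 powr (- (real l * s * p)) * 2 powr (- (real (l - n) * ((real M - s) * p)))"
    using False by (simp add: powr_add[symmetric] of_nat_diff algebra_simps)
  also have "2 powr (- (real (l - n) * ((real M - s) * p))) \<le> 2 powr (real (gap n l) * - min (s * p) ((real M - s) * p))"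
    using False by (intro powr_mono) (auto simp: gap_def intro!: mult_left_mono)
  also have "\<dots> = rate ^ gap n l"
    unfolding rate_def by (simp add: powr_realpow[symmetric] powr_powr mult.commute)
  finally show ?thesis by simp
qed

lemma nn_integral_fin_diff_spike_sum_shell:
  assumes A: "\<And>n. mass n \<le> A"
  shows "\<exists>D\<ge>0. \<forall>l h. norm h \<le> (1/2) ^ l \<longrightarrow>
     (\<integral>\<^sup>+z. ennreal (\<bar>fin_diff M h spike_sum z\<bar> powr p) \<partial>lebesgue) \<le>
     ennreal (D * 2 powr (- (real l * s * p)) * gap_conv mass rate l)"
proof -
  obtain C where C: "0 < C" "\<And>h z. \<bar>fin_diff M h (bump (M + 1)) (z::'a \<times> 'b)\<bar> \<le> C * min 1 (norm h) ^ M"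
    using fin_diff_bump[of M "M + 1", where 'a = "'a \<times> 'b"] by auto
  define D where "D = C powr p * real (M + 1) * unit_ball_vol (real DIM('a \<times> 'b))"
  have D: "0 \<le> D" by (simp add: D_def)
  have "(\<integral>\<^sup>+z. ennreal (\<bar>fin_diff M h spike_sum z\<bar> powr p) \<partial>lebesgue) \<le>
     ennreal (D * 2 powr (- (real l * s * p)) * gap_conv mass rate l)"
    if h: "norm h \<le> (1/2) ^ l" for l h
  proof -
    have sm: "summable (\<lambda>n. mass n * rate ^ gap n l)"
      by (rule summable_gap_conv[OF rate mass_nonneg A])
    have h1: "norm h \<le> 1" using h power_le_one[of "1/2::real" l] by simp
    have "(\<integral>\<^sup>+z. ennreal (\<bar>fin_diff M h spike_sum z\<bar> powr p) \<partial>lebesgue) \<le>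
       (\<Sum>n. ennreal (D * (mass n * (2 powr (- (real n * s * p)) * (min 1 (2 ^ n * norm h) ^ M) powr p))))"
      unfolding D_def by (rule nn_integral_fin_diff_spike_sum_le[OF C(2,1) order_refl h1])
    also have "\<dots> \<le> (\<Sum>n. ennreal ((D * 2 powr (- (real l * s * p))) * (mass n * rate ^ gap n l)))"
    proof (intro suminf_le ennreal_leI)
      fix n
      have "2 powr (- (real n * s * p)) * (min 1 (2 ^ n * norm h) ^ M) powr p \<le>
         2 powr (- (real n * s * p)) * (min 1 (2 ^ n * (1/2) ^ l) ^ M) powr p"
      proof (intro mult_left_mono powr_mono2 power_mono min.mono order_refl h)
      qed (use p_pos in auto)
      also have "\<dots> \<le> 2 powr (- (real l * s * p)) * rate ^ gap n l"
        by (rule fin_diff_power_le_rate)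
      finally have "D * (mass n * (2 powr (- (real n * s * p)) * (min 1 (2 ^ n * norm h) ^ M) powr p))
         \<le> D * (mass n * (2 powr (- (real l * s * p)) * rate ^ gap n l))"
        using D mass_nonneg by (intro mult_left_mono)
      then show "D * (mass n * (2 powr (- (real n * s * p)) * (min 1 (2 ^ n * norm h) ^ M) powr p))
         \<le> (D * 2 powr (- (real l * s * p))) * (mass n * rate ^ gap n l)"
        by (simp only: mult_ac)
    qed auto
    also have "\<dots> = ennreal (\<Sum>n. (D * 2 powr (- (real l * s * p))) * (mass n * rate ^ gap n l))"
      using D mass_nonneg rate by (intro suminf_ennreal2 summable_mult sm) (auto intro!: mult_nonneg_nonneg)
    also have "(\<Sum>n. (D * 2 powr (- (real l * s * p))) * (mass n * rate ^ gap n l)) =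
        D * 2 powr (- (real l * s * p)) * gap_conv mass rate l"
      unfolding gap_conv_def by (rule suminf_mult[OF sm])
    finally show ?thesis .
  qed
  with D show ?thesis by blast
qed

text \<open>
  The function is its own difference of order \<open>0\<close>, so that the estimate for differences applies.
\<close>

lemma nn_integral_spike_sum_finite:
  assumes A: "\<And>n. mass n \<le> A"
  shows "(\<integral>\<^sup>+z. ennreal (\<bar>spike_sum z\<bar> powr p) \<partial>lebesgue) < \<infinity>"
proof -
  have C: "\<bar>fin_diff 0 h (bump (M + 1)) (z::'a \<times> 'b)\<bar> \<le> 1 * min 1 (norm h) ^ 0" for h z
    by (simp add: fin_diff_0 bump_nonneg bump_le_1)
  define w where "w = unit_ball_vol (real DIM('a \<times> 'b))"
  define b where "b = (2::real) powr (- (s * p))"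
  have b: "0 < b" "b < 1" using s_pos p_pos powr_less_mono[of "- (s * p)" 0 2] by (auto simp: b_def)
  have sm: "summable (\<lambda>n. w * A * b ^ n)" using b by (intro summable_mult summable_geometric) auto
  have "(\<integral>\<^sup>+z. ennreal (\<bar>spike_sum z\<bar> powr p) \<partial>lebesgue) =
     (\<integral>\<^sup>+z. ennreal (\<bar>fin_diff 0 0 spike_sum z\<bar> powr p) \<partial>lebesgue)" by (simp add: fin_diff_0)
  also have "\<dots> \<le> (\<Sum>n. ennreal (1 powr p * real (0 + 1) * w *
        (mass n * (2 powr (- (real n * s * p)) * (min 1 (2 ^ n * norm (0::'a \<times> 'b)) ^ 0) powr p))))"
    unfolding w_def by (rule nn_integral_fin_diff_spike_sum_le[OF C]) auto
  also have "\<dots> \<le> (\<Sum>n. ennreal (w * A * b ^ n))"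
  proof (intro suminf_le ennreal_leI)
    fix n
    have "2 powr (- (real n * s * p)) = b ^ n"
      unfolding b_def by (simp add: powr_realpow[symmetric] powr_powr algebra_simps)
    moreover have "w * (mass n * b ^ n) \<le> w * (A * b ^ n)"
      using A b by (intro mult_left_mono mult_right_mono) (auto simp: w_def)
    ultimately show "1 powr p * real (0 + 1) * w *
        (mass n * (2 powr (- (real n * s * p)) * (min 1 (2 ^ n * norm (0::'a \<times> 'b)) ^ 0) powr p)) \<le> w * A * b ^ n"
      by simp
  qed auto
  also have "\<dots> = ennreal (\<Sum>n. w * A * b ^ n)"
    using b order_trans[OF mass_nonneg A] by (intro suminf_ennreal2 sm) (auto simp: w_def)
  finally show ?thesis by (rule order.strict_trans1) simp
qed

text \<open>
  Cut the unit ball into dyadic shells.  On each shell the power of \<open>norm h\<close> in the seminorm cancels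
  the factor \<open>2 powr (- l s p)\<close> of the previous estimate and, for \<open>q < \<infinity>\<close>, the volume of the shell.
  What remains is the supremum, respectively the sum of the \<open>u\<close>-th powers, of the convolution
  of \<open>mass\<close> with the geometric kernel, where \<open>u = q / p\<close>.  For \<open>q = \<infinity>\<close> any exponent \<open>u\<close> will do, as it
  only serves to make the masses bounded.
\<close>

lemma spike_sum_in_besov_space:
  assumes M: "M = nat \<lfloor>s\<rfloor> + 1" and u: "0 < u" and sum: "summable (\<lambda>n. mass n powr u)"
    and q: "q = \<infinity> \<or> q = ennreal (p * u)"
  shows "spike_sum \<in> besov_space s (ennreal p) q"
proof -
  obtain A where A: "0 \<le> A" "\<And>n. mass n \<le> A"
    using summable_powr_imp_bounded[OF sum mass_nonneg u] by blast
  obtain D where D: "0 \<le> D" "\<And>l h. norm h \<le> (1/2) ^ l \<Longrightarrow>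
     (\<integral>\<^sup>+z. ennreal (\<bar>fin_diff M h spike_sum z\<bar> powr p) \<partial>lebesgue) \<le>
     ennreal (D * 2 powr (- (real l * s * p)) * gap_conv mass rate l)"
    using nn_integral_fin_diff_spike_sum_shell[OF A(2)] by blast
  define g where "g = gap_conv mass rate"
  define G where "G = A * (2 / (1 - rate))"
  have g: "0 \<le> g l" "g l \<le> G" for l
    unfolding g_def G_def
    by (rule gap_conv_nonneg[OF rate mass_nonneg A(2)], rule summable_gap_conv(2)[OF rate mass_nonneg A(2)])
  have Lp: "spike_sum \<in> Lp_space (ennreal p)"
  proof -
    have "spike_sum \<in> borel_measurable lebesgue"
      using borel_measurable_spike_sum by (simp add: measurable_completion)
    moreover have "Lp_norm (ennreal p) spike_sum < \<infinity>"
      using nn_integral_spike_sum_finite[OF A(2)] p_pos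
      by (simp add: Lp_norm_def ennpowr_less_top)
    ultimately show ?thesis by (simp add: Lp_space_def)
  qed
  have norm_le: "Lp_norm (ennreal p) (fin_diff M h spike_sum) \<le>
      ennreal ((D * 2 powr (- (real l * s * p)) * g l) powr (1 / p))"
    if "norm h \<le> (1/2) ^ l" for l h
    unfolding g_def using D(2)[OF that] D(1) g(1)[of l] p_pos
    by (intro Lp_norm_le) (auto simp: g_def)
  have half: "norm h powr (- t) \<le> 2 powr (real (Suc l) * t)" if "(1/2) ^ Suc l < norm h" "0 \<le> t" for l t and h :: "'a \<times> 'b"
  proof -
    have "norm h powr (- t) \<le> ((1/2) ^ Suc l) powr (- t)"
      using that by (intro powr_mono2') auto
    also have "\<dots> = 2 powr (real (Suc l) * t)"
      unfolding half_power_eq_powr by (simp add: powr_powr algebra_simps)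
    finally show ?thesis .
  qed
  have semi: "besov_seminorm M s (ennreal p) q spike_sum < \<infinity>"
    using q
  proof
    assume q: "q = \<infinity>"
    have "ennreal (norm h powr - s) * Lp_norm (ennreal p) (fin_diff M h spike_sum) \<le>
        ennreal (2 powr s * (D * G) powr (1 / p))" if h: "0 < norm h" "norm h \<le> 1" for h
    proof -
      obtain l where l: "(1/2) ^ Suc l < norm h" "norm h \<le> (1/2) ^ l"
        using dyadic_shell[OF h] by blast
      have "ennreal (norm h powr - s) * Lp_norm (ennreal p) (fin_diff M h spike_sum) \<le>
         ennreal (2 powr (real (Suc l) * s)) * ennreal ((D * 2 powr (- (real l * s * p)) * g l) powr (1 / p))"
        using half[OF l(1), of s] s_pos by (intro mult_mono norm_le l ennreal_leI) auto
      also have "\<dots> = ennreal (2 powr (real (Suc l) * s) * (D * 2 powr (- (real l * s * p)) * g l) powr (1 / p))"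
        by (rule ennreal_mult[symmetric]) auto
      also have "2 powr (real (Suc l) * s) * (D * 2 powr (- (real l * s * p)) * g l) powr (1 / p)
          = 2 powr s * (D * g l) powr (1 / p)"
      proof -
        have "(D * 2 powr (- (real l * s * p)) * g l) powr (1 / p) = 2 powr (- (real l * s)) * (D * g l) powr (1 / p)"
          using D(1) g(1)[of l] p_pos by (simp add: powr_mult powr_powr)
        moreover have "2 powr (real (Suc l) * s) * 2 powr (- (real l * s)) = 2 powr s"
          by (simp add: powr_add[symmetric] algebra_simps)
        ultimately show ?thesis by (simp add: mult.assoc[symmetric])
      qed
      also have "\<dots> \<le> 2 powr s * (D * G) powr (1 / p)"
        using D(1) g[of l] p_pos by (intro mult_left_mono powr_mono2 mult_left_mono) auto
      finally show ?thesis by (simp add: ennreal_leI)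
    qed
    then have "besov_seminorm M s (ennreal p) q spike_sum \<le> ennreal (2 powr s * (D * G) powr (1 / p))"
      unfolding besov_seminorm_def q by (auto intro!: SUP_least)
    then show ?thesis by (rule order.strict_trans1) simp
  next
    assume q: "q = ennreal (p * u)"
    define N where "N = real DIM('a \<times> 'b)"
    define \<kappa> where "\<kappa> = D powr u * 2 powr (N + s * (p * u))"
    define w where "w = unit_ball_vol N"
    have \<kappa>: "0 \<le> \<kappa>" by (simp add: \<kappa>_def)
    have w: "0 \<le> w" by (simp add: w_def N_def)
    let ?t = "\<lambda>l h. ennreal (\<kappa> * g l powr u * 2 powr (real l * N)) * indicator (cball 0 ((1/2) ^ l)) (h::'a \<times> 'b)"
    let ?f = "\<lambda>h. ennpowr (Lp_norm (ennreal p) (fin_diff M h spike_sum)) (p * u) * ennreal (norm h powr - (N + s * (p * u)))"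
    have pw: "?f h * indicator {h. norm h \<le> 1} h \<le> (\<Sum>l. ?t l h)" for h :: "'a \<times> 'b"
    proof (cases "0 < norm h \<and> norm h \<le> 1")
      case True
      then obtain l where l: "(1/2) ^ Suc l < norm h" "norm h \<le> (1/2) ^ l"
        using dyadic_shell by blast
      have "ennpowr (Lp_norm (ennreal p) (fin_diff M h spike_sum)) (p * u) \<le>
        ennreal (((D * 2 powr (- (real l * s * p)) * g l) powr (1 / p)) powr (p * u))"
        using p_pos u by (intro ennpowr_mono norm_le l) auto
      also have "((D * 2 powr (- (real l * s * p)) * g l) powr (1 / p)) powr (p * u) =
         D powr u * 2 powr (- (real l * s * p * u)) * g l powr u"
        using p_pos D(1) g(1)[of l] by (simp add: powr_powr powr_mult mult.assoc)
      finally have "?f h \<le> ennreal (D powr u * 2 powr (- (real l * s * p * u)) * g l powr u) *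
           ennreal (2 powr (real (Suc l) * (N + s * (p * u))))"
        using half[OF l(1), of "N + s * (p * u)"] s_pos p_pos u
        by (intro mult_mono ennreal_leI) (auto simp: N_def)
      also have "\<dots> = ennreal (D powr u * 2 powr (- (real l * s * p * u)) * g l powr u *
           2 powr (real (Suc l) * (N + s * (p * u))))"
        by (rule ennreal_mult[symmetric]) auto
      also have "D powr u * 2 powr (- (real l * s * p * u)) * g l powr u *
           2 powr (real (Suc l) * (N + s * (p * u))) = \<kappa> * g l powr u * 2 powr (real l * N)"
      proof -
        have "2 powr (- (real l * s * p * u)) * 2 powr (real (Suc l) * (N + s * (p * u))) =
            2 powr (N + s * (p * u)) * 2 powr (real l * N)"
          unfolding powr_add[symmetric] by (simp add: algebra_simps)
        then show ?thesis unfolding \<kappa>_def by (simp add: mult_ac)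
      qed
      finally have "?f h * indicator {h. norm h \<le> 1} h \<le> ?t l h"
        using True l(2) by simp
      also have "\<dots> = (\<Sum>k\<in>{l}. ?t k h)"
        by (simp only: sum.insert_if sum.empty finite.emptyI empty_iff if_False add_0_right)
      also have "\<dots> \<le> (\<Sum>l. ?t l h)" by (rule sum_le_suminf) auto
      finally show ?thesis .
    qed auto
    have sg: "summable (\<lambda>l. \<kappa> * w * g l powr u)"
      unfolding g_def by (intro summable_mult summable_gap_conv_powr rate mass_nonneg u sum)
    have "(\<integral>\<^sup>+h\<in>{h. norm h \<le> 1}. ?f h \<partial>lebesgue) \<le> (\<integral>\<^sup>+h. (\<Sum>l. ?t l h) \<partial>lebesgue)"
      by (rule nn_integral_mono) (rule pw)
    also have "\<dots> = (\<Sum>l. \<integral>\<^sup>+h. ?t l h \<partial>lebesgue)"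
      unfolding nn_integral_completion
      by (intro nn_integral_suminf borel_measurable_times_ennreal borel_measurable_const
            borel_measurable_indicator) simp
    also have "\<dots> = (\<Sum>l. ennreal (\<kappa> * w * g l powr u))"
    proof (intro suminf_cong)
      fix l
      have "(\<integral>\<^sup>+h. ?t l h \<partial>lebesgue) =
         ennreal (\<kappa> * g l powr u * 2 powr (real l * N)) * ennreal (w * ((1/2) ^ l) ^ DIM('a \<times> 'b))"
        unfolding nn_integral_completion w_def N_def
        by (subst nn_integral_cmult_indicator) (auto simp: emeasure_cball)
      also have "((1/2::real) ^ l) ^ DIM('a \<times> 'b) = 2 powr (- (real l * N))"
        unfolding power_mult[symmetric] N_def unfolding half_power_eq_powr by simp
      also have "ennreal (\<kappa> * g l powr u * 2 powr (real l * N)) * ennreal (w * 2 powr (- (real l * N)))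
          = ennreal (\<kappa> * g l powr u * 2 powr (real l * N) * (w * 2 powr (- (real l * N))))"
        using \<kappa> w by (intro ennreal_mult[symmetric]) auto
      also have "\<kappa> * g l powr u * 2 powr (real l * N) * (w * 2 powr (- (real l * N))) = \<kappa> * w * g l powr u"
        by (simp add: powr_minus field_simps)
      finally show "(\<integral>\<^sup>+h. ?t l h \<partial>lebesgue) = ennreal (\<kappa> * w * g l powr u)" .
    qed
    also have "\<dots> = ennreal (\<Sum>l. \<kappa> * w * g l powr u)"
      using \<kappa> w by (intro suminf_ennreal2 sg) auto
    finally have "(\<integral>\<^sup>+h\<in>{h. norm h \<le> 1}. ?f h \<partial>lebesgue) < \<infinity>"
      by (rule order.strict_trans1) simp
    then show ?thesis
      using p_pos u unfolding besov_seminorm_def q N_def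
      by (simp add: ennpowr_less_top del: DIM_prod)
  qed
  from Lp semi show ?thesis by (simp add: besov_space_def M)
qed

end

section \<open>Functions with arbitrarily tall peaks\<close>

text \<open>
  For every factor \<open>\<Lambda>\<close> there is a peak of some radius \<open>r\<close> and of height at least \<open>\<Lambda> r\<^sup>\<beta>\<close> which is
  surrounded by an annulus, of outer radius \<open>R\<close>, where the function vanishes.  The annulus makes the
  peak visible to mean oscillations and to finite differences.
\<close>

definition tall_peaks :: "real \<Rightarrow> real \<Rightarrow> ('a::euclidean_space \<Rightarrow> real) \<Rightarrow> bool" where
  "tall_peaks \<beta> R g \<longleftrightarrow> (\<forall>\<Lambda>>0. \<exists>x0 r. 0 < r \<and> r \<le> 1/2 \<and>
      (\<forall>x. norm (x - x0) \<le> r / 2 \<longrightarrow> \<Lambda> * r powr \<beta> \<le> g x) \<and>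
      (\<forall>x. r \<le> norm (x - x0) \<longrightarrow> norm (x - x0) \<le> R \<longrightarrow> g x = 0))"

text \<open>
  The rearrangement at half the volume of the inner ball of a peak is at least the height of
  the peak, and \<open>t powr (1 / \<rho>)\<close> cancels the power of \<open>r\<close>.
\<close>

lemma tall_peaks_imp_not_weak_Lp:
  fixes g :: "'a::euclidean_space \<Rightarrow> real"
  assumes "tall_peaks (- (real DIM('a) / \<rho>)) R g" "0 < \<rho>"
  shows "g \<notin> weak_Lp_space \<rho>"
proof
  assume "g \<in> weak_Lp_space \<rho>"
  then have g: "g \<in> borel_measurable lebesgue"
    and "(SUP t\<in>{0<..}. ennreal (t powr (1 / \<rho>)) * decr_rearr g t) < top"
    by (auto simp: weak_Lp_space_def)
  then obtain S where S: "0 \<le> S" "(SUP t\<in>{0<..}. ennreal (t powr (1 / \<rho>)) * decr_rearr g t) = ennreal S"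
    by (cases "SUP t\<in>{0<..}. ennreal (t powr (1 / \<rho>)) * decr_rearr g t") auto
  define w where "w = unit_ball_vol (real DIM('a))"
  have w: "0 < w" by (simp add: w_def)
  define \<kappa> where "\<kappa> = (w * (1/2) ^ DIM('a) / 2) powr (1 / \<rho>)"
  have \<kappa>: "0 < \<kappa>" using w by (simp add: \<kappa>_def)
  define \<Lambda> where "\<Lambda> = (S + 1) / \<kappa>"
  have \<Lambda>: "0 < \<Lambda>" using S \<kappa> by (simp add: \<Lambda>_def)
  obtain x0 r where r: "0 < r"
    and peak: "\<And>x. norm (x - x0) \<le> r / 2 \<Longrightarrow> \<Lambda> * r powr (- (real DIM('a) / \<rho>)) \<le> g x"
    using assms(1) \<Lambda> unfolding tall_peaks_def by meson
  define \<alpha> where "\<alpha> = \<Lambda> * r powr (- (real DIM('a) / \<rho>))"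
  have \<alpha>: "0 < \<alpha>" using \<Lambda> r by (simp add: \<alpha>_def)
  define t where "t = w * (r / 2) ^ DIM('a) / 2"
  have t: "0 < t" using w r by (simp add: t_def)
  have "ennreal \<alpha> \<le> decr_rearr g t"
    unfolding decr_rearr_def
  proof (rule INF_greatest, safe)
    fix c :: real assume c: "0 \<le> c" "emeasure lebesgue {x. c < \<bar>g x\<bar>} \<le> ennreal t"
    show "ennreal \<alpha> \<le> ennreal c"
    proof (rule ccontr)
      assume "\<not> ennreal \<alpha> \<le> ennreal c"
      then have "c < \<alpha>" by (meson ennreal_leI not_le)
      have "ball x0 (r / 2) \<subseteq> {x. c < \<bar>g x\<bar>}"
      proof safe
        fix x assume "x \<in> ball x0 (r / 2)"
        then have "\<alpha> \<le> g x" using peak[of x] by (simp add: \<alpha>_def dist_norm norm_minus_commute)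
        then show "c < \<bar>g x\<bar>" using \<open>c < \<alpha>\<close> by linarith
      qed
      moreover have "{x. c < \<bar>g x\<bar>} \<in> sets lebesgue"
      proof -
        have "{x \<in> space lebesgue. c < \<bar>g x\<bar>} \<in> sets lebesgue" using g by measurable
        then show ?thesis by simp
      qed
      ultimately have "emeasure lebesgue (ball x0 (r / 2)) \<le> emeasure lebesgue {x. c < \<bar>g x\<bar>}"
        by (rule emeasure_mono)
      also have "\<dots> \<le> ennreal t" by (rule c)
      finally have "w * (r / 2) ^ DIM('a) \<le> t"
        using r t by (simp add: emeasure_ball w_def)
      then show False using t by (simp add: t_def)
    qed
  qed
  then have "ennreal (t powr (1 / \<rho>)) * ennreal \<alpha> \<le> ennreal (t powr (1 / \<rho>)) * decr_rearr g t"
    by (intro mult_left_mono) auto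
  also have "\<dots> \<le> ennreal S"
    unfolding S(2)[symmetric] using t by (intro SUP_upper) auto
  finally have "t powr (1 / \<rho>) * \<alpha> \<le> S"
    using S \<alpha> by (simp add: ennreal_mult''[symmetric])
  moreover have "t powr (1 / \<rho>) = \<kappa> * r powr (real DIM('a) / \<rho>)"
  proof -
    have t_eq: "t = (w * (1/2) ^ DIM('a) / 2) * r powr real DIM('a)"
      using r by (simp add: t_def powr_realpow power_divide)
    show ?thesis unfolding t_eq \<kappa>_def using w r
      by (subst powr_mult) (auto simp: powr_powr)
  qed
  ultimately have "\<kappa> * \<Lambda> * (r powr (real DIM('a) / \<rho>) * r powr (- (real DIM('a) / \<rho>))) \<le> S"
    by (simp add: \<alpha>_def mult_ac)
  then have "\<kappa> * \<Lambda> \<le> S" using r by (simp add: powr_add[symmetric])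
  then show False using \<kappa> by (simp add: \<Lambda>_def)
qed

text \<open>
  Compare the values on two balls of the same size inside \<open>ball x0 (2 * r)\<close>: the function is at least
  \<open>\<Lambda>\<close> on the inner ball \<open>B1\<close> and \<open>0\<close> on the ball \<open>B2\<close> in the annulus.  Whatever the mean \<open>c\<close> is, the
  integrals of \<open>\<Lambda> - c\<close> over \<open>B1\<close> and of \<open>c\<close> over \<open>B2\<close> add up to \<open>\<Lambda>\<close> times the volume of one of them.
\<close>

lemma tall_peaks_imp_not_bmo:
  fixes g :: "'a::euclidean_space \<Rightarrow> real"
  assumes "tall_peaks 0 R g" "1 \<le> R"
  shows "g \<notin> bmo_space"
proof
  assume "g \<in> bmo_space"
  then obtain C where int: "\<And>K. compact K \<Longrightarrow> set_integrable lebesgue K g"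
    and C: "\<And>z r. 0 < r \<Longrightarrow> mean_on (ball z r) (\<lambda>x. \<bar>g x - mean_on (ball z r) g\<bar>) \<le> C"
    unfolding bmo_space_def by auto
  \<comment> \<open>\<open>4 ^ DIM('a)\<close> is the ratio of the volumes of \<open>B\<close> and \<open>B1\<close>.\<close>
  define \<Lambda> where "\<Lambda> = (\<bar>C\<bar> + 1) * 4 ^ DIM('a)"
  have \<Lambda>: "0 < \<Lambda>" by (simp add: \<Lambda>_def)
  obtain x0 r where r: "0 < r" "r \<le> 1/2"
    and peak: "\<And>x. norm (x - x0) \<le> r / 2 \<Longrightarrow> \<Lambda> * r powr 0 \<le> g x"
    and zero: "\<And>x. r \<le> norm (x - x0) \<Longrightarrow> norm (x - x0) \<le> R \<Longrightarrow> g x = 0"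
    using assms(1) \<Lambda> unfolding tall_peaks_def by meson
  obtain b :: 'a where b: "norm b = 1" using vector_choose_size[of 1] by auto
  define B where "B = ball x0 (2 * r)"
  define B1 where "B1 = ball x0 (r / 2)"
  define B2 where "B2 = ball (x0 + (3/2 * r) *\<^sub>R b) (r / 2)"
  define c where "c = mean_on B g"
  let ?F = "\<lambda>x. (\<Lambda> - c) * indicator B1 x + c * indicator B2 x"
  have B1: "B1 \<subseteq> B" using r by (auto simp: B1_def B_def)
  have B2': "r < norm (x - x0) \<and> norm (x - x0) < 2 * r" if "x \<in> B2" for x
  proof -
    have 1: "norm (x - (x0 + (3/2 * r) *\<^sub>R b)) < r / 2"
      using that by (simp add: B2_def dist_norm norm_minus_commute)
    have 2: "norm ((3/2 * r) *\<^sub>R b) = 3/2 * r" using b r by simp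
    have "norm (x - x0) \<le> norm (x - (x0 + (3/2 * r) *\<^sub>R b)) + norm ((3/2 * r) *\<^sub>R b)"
      using norm_triangle_ineq[of "x - (x0 + (3/2 * r) *\<^sub>R b)" "(3/2 * r) *\<^sub>R b"] by simp
    moreover have "norm ((3/2 * r) *\<^sub>R b) \<le> norm (x - x0) + norm (x - (x0 + (3/2 * r) *\<^sub>R b))"
      using norm_triangle_ineq4[of "x - x0" "x - (x0 + (3/2 * r) *\<^sub>R b)"] by simp
    ultimately show ?thesis using 1 2 by linarith
  qed
  have B2: "B2 \<subseteq> B" using B2' by (auto simp: B_def dist_norm norm_minus_commute)
  have disj: "x \<notin> B2" if "x \<in> B1" for x
    using that B2'[of x] r by (auto simp: B1_def dist_norm norm_minus_commute)
  have sets: "B \<in> sets lebesgue" "B1 \<in> sets lebesgue" "B2 \<in> sets lebesgue"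
    by (auto simp: B_def B1_def B2_def)
  have fin: "emeasure lebesgue B < \<infinity>" "emeasure lebesgue B1 < \<infinity>" "emeasure lebesgue B2 < \<infinity>"
    using r by (auto simp: B_def B1_def B2_def emeasure_ball)
  have ptw: "?F x \<le> \<bar>g x - c\<bar>" if "x \<in> B" for x
  proof (cases "x \<in> B1")
    case True
    then have "\<Lambda> \<le> g x" using peak[of x] r by (simp add: B1_def dist_norm norm_minus_commute)
    then show ?thesis using True disj by simp
  next
    case False
    show ?thesis
    proof (cases "x \<in> B2")
      case True
      then have "g x = 0" using B2'[OF True] assms(2) r by (intro zero) auto
      then show ?thesis using True False by simp
    qed (use False in simp)
  qed
  have intB: "set_integrable lebesgue B (\<lambda>x. \<bar>g x - c\<bar>)"
  proof -
    have "set_integrable lebesgue B g"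
      by (rule set_integrable_subset[OF int[of "cball x0 (2 * r)"]]) (auto simp: B_def)
    moreover have "set_integrable lebesgue B (\<lambda>x. c)"
      unfolding set_integrable_def using sets fin
      by (intro integrable_scaleR_left integrable_real_indicator)
    ultimately show ?thesis by (intro set_integrable_abs set_integral_diff(1))
  qed
  have intI: "integrable lebesgue (indicator B1 :: 'a \<Rightarrow> real)" "integrable lebesgue (indicator B2 :: 'a \<Rightarrow> real)"
    using sets fin by auto
  have ind: "indicator B x *\<^sub>R ?F x = ?F x" for x
    using B1 B2 by (auto simp: indicator_def)
  have intF: "set_integrable lebesgue B ?F"
    unfolding set_integrable_def ind using intI by (intro Bochner_Integration.integrable_add integrable_mult_right)
  have m: "measure lebesgue B1 = measure lebesgue B2" "0 < measure lebesgue B1"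
    unfolding B1_def B2_def using r by (simp_all add: content_ball)
  have m4: "measure lebesgue B = 4 ^ DIM('a) * measure lebesgue B1"
  proof -
    have "(2 * r) ^ DIM('a) = 4 ^ DIM('a) * (r / 2) ^ DIM('a)"
      unfolding power_mult_distrib[symmetric] by simp
    then show ?thesis unfolding B1_def B_def using r by (simp add: content_ball)
  qed
  have "\<Lambda> * measure lebesgue B1 = (LINT x|lebesgue. ?F x)"
    using intI m(1) by (simp add: algebra_simps)
  also have "\<dots> = (LINT x:B|lebesgue. ?F x)"
    unfolding set_lebesgue_integral_def ind ..
  also have "\<dots> \<le> (LINT x:B|lebesgue. \<bar>g x - c\<bar>)"
    by (rule set_integral_mono[OF intF intB ptw])
  finally have "\<Lambda> * measure lebesgue B1 / measure lebesgue B \<le> mean_on B (\<lambda>x. \<bar>g x - c\<bar>)"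
    by (simp add: mean_on_def divide_right_mono)
  also have "\<dots> \<le> C" unfolding c_def B_def using r by (intro C) auto
  finally have "\<bar>C\<bar> + 1 \<le> C" using m m4 by (simp add: \<Lambda>_def)
  then show False by linarith
qed

text \<open>
  Choose \<open>h\<close> of length \<open>2 * r\<close>.  For \<open>x\<close> in the inner ball of a peak, all points \<open>x + j *\<^sub>R h\<close> with
  \<open>j > 0\<close> lie in the annulus, so the difference at \<open>x\<close> is \<open>\<plusminus> g x\<close>.  The bound on \<open>R\<close> comes from
  \<open>j * (2 * r) + r / 2 \<le> j + 1\<close> and \<open>j \<le> nat \<lfloor>\<alpha>\<rfloor> + 1\<close>.
\<close>

lemma tall_peaks_imp_not_zygmund:
  fixes g :: "'a::euclidean_space \<Rightarrow> real"
  assumes "tall_peaks \<alpha> R g" "0 < \<alpha>" "real (nat \<lfloor>\<alpha>\<rfloor> + 2) \<le> R"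
  shows "g \<notin> zygmund_space \<alpha>"
proof
  define k where "k = nat \<lfloor>\<alpha>\<rfloor> + 1"
  assume "g \<in> zygmund_space \<alpha>"
  then have "besov_seminorm k \<alpha> \<infinity> \<infinity> g < top"
    by (auto simp: zygmund_space_def besov_space_def k_def)
  then obtain S where S: "0 \<le> S" "besov_seminorm k \<alpha> \<infinity> \<infinity> g = ennreal S"
    by (cases "besov_seminorm k \<alpha> \<infinity> \<infinity> g") auto
  have bound: "ennreal (norm h powr - \<alpha>) * Lp_norm \<infinity> (fin_diff k h g) \<le> ennreal S"
    if "0 < norm h" "norm h \<le> 1" for h
    unfolding S(2)[symmetric] besov_seminorm_def using that by (auto intro!: SUP_upper)
  \<comment> \<open>The factor makes up for \<open>h\<close> being twice as long as \<open>r\<close>.\<close>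
  define \<Lambda> where "\<Lambda> = (S + 1) * 2 powr \<alpha>"
  have \<Lambda>: "0 < \<Lambda>" using S by (simp add: \<Lambda>_def)
  obtain x0 r where r: "0 < r" "r \<le> 1/2"
    and peak: "\<And>x. norm (x - x0) \<le> r / 2 \<Longrightarrow> \<Lambda> * r powr \<alpha> \<le> g x"
    and zero: "\<And>x. r \<le> norm (x - x0) \<Longrightarrow> norm (x - x0) \<le> R \<Longrightarrow> g x = 0"
    using assms(1) \<Lambda> unfolding tall_peaks_def by meson
  obtain b :: 'a where b: "norm b = 1" using vector_choose_size[of 1] by auto
  define h where "h = (2 * r) *\<^sub>R b"
  have h: "norm h = 2 * r" using b r by (simp add: h_def)
  have diff: "\<Lambda> * r powr \<alpha> \<le> \<bar>fin_diff k h g x\<bar>" if x: "x \<in> ball x0 (r / 2)" for x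
  proof -
    have x': "norm (x - x0) < r / 2" using x by (simp add: dist_norm norm_minus_commute)
    have "g (x + real j *\<^sub>R h) = 0" if j: "j \<le> k" "j \<noteq> 0" for j
    proof (rule zero)
      have n: "norm (real j *\<^sub>R h) = real j * (2 * r)" using h by simp
      have "norm (real j *\<^sub>R h) \<le> norm (x + real j *\<^sub>R h - x0) + norm (x - x0)"
        using norm_triangle_ineq4[of "x + real j *\<^sub>R h - x0" "x - x0"] by simp
      moreover have "1 * (2 * r) \<le> real j * (2 * r)" using j r by (intro mult_right_mono) auto
      ultimately show "r \<le> norm (x + real j *\<^sub>R h - x0)" using n x' r by linarith
      have "norm (x + real j *\<^sub>R h - x0) \<le> norm (x - x0) + norm (real j *\<^sub>R h)"
        using norm_triangle_ineq[of "x - x0" "real j *\<^sub>R h"] by (simp add: algebra_simps)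
      moreover have "real j * (2 * r) \<le> real k * 1" using j r by (intro mult_mono) auto
      moreover have "real k + 1 \<le> R" using assms(3) by (simp add: k_def)
      ultimately show "norm (x + real j *\<^sub>R h - x0) \<le> R" using n x' r by linarith
    qed
    then have "fin_diff k h g x = (\<Sum>j\<in>{0}. (-1) ^ (k - j) * real (k choose j) * g (x + real j *\<^sub>R h))"
      unfolding fin_diff_def by (intro sum.mono_neutral_right) auto
    then have "\<bar>fin_diff k h g x\<bar> = \<bar>g x\<bar>" by (simp add: abs_mult)
    then show ?thesis using peak[of x] x' by linarith
  qed
  have "ennreal (\<Lambda> * r powr \<alpha>) \<le> Lp_norm \<infinity> (fin_diff k h g)"
  proof (rule ccontr)
    assume "\<not> ?thesis"
    then have less: "esssup lebesgue (\<lambda>x. ennreal \<bar>fin_diff k h g x\<bar>) < ennreal (\<Lambda> * r powr \<alpha>)"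
      by (simp add: Lp_norm_def)
    have "AE x in lebesgue. x \<notin> ball x0 (r / 2)"
      using esssup_AE[of "\<lambda>x. ennreal \<bar>fin_diff k h g x\<bar>" lebesgue]
    proof eventually_elim
      case (elim x)
      then have "ennreal \<bar>fin_diff k h g x\<bar> < ennreal (\<Lambda> * r powr \<alpha>)" using less by (rule order.strict_trans1)
      then show ?case using diff[of x] by (meson ennreal_leI not_le)
    qed
    then have "emeasure lebesgue (ball x0 (r / 2)) = 0"
      by (subst (asm) AE_iff_measurable[of "ball x0 (r / 2)"]) auto
    then show False using r unit_ball_vol_pos[of "real DIM('a)"] by (simp add: emeasure_ball)
  qed
  then have "ennreal (norm h powr - \<alpha>) * ennreal (\<Lambda> * r powr \<alpha>) \<le> ennreal (norm h powr - \<alpha>) * Lp_norm \<infinity> (fin_diff k h g)"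
    by (intro mult_left_mono) auto
  also have "\<dots> \<le> ennreal S" using h r by (intro bound) auto
  finally have "norm h powr - \<alpha> * (\<Lambda> * r powr \<alpha>) \<le> S"
    using S \<Lambda> by (simp add: ennreal_mult''[symmetric])
  moreover have "norm h powr - \<alpha> * (\<Lambda> * r powr \<alpha>) = S + 1"
    using r by (simp add: h \<Lambda>_def powr_mult powr_minus field_simps)
  ultimately show False by simp
qed

lemma tall_peaks_imp_not_A_space:
  fixes g :: "'a::euclidean_space \<Rightarrow> real"
  assumes "tall_peaks (s - real DIM('a) / p) R g" "0 < p" "0 < s" "real (nat \<lfloor>s\<rfloor> + 2) \<le> R"
  shows "g \<notin> A_space s p"
proof -
  let ?n = "real DIM('a)"
  consider "?n < s * p" | "s * p = ?n" | "s * p < ?n" by linarith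
  then show ?thesis
  proof cases
    case 1
    then have "0 < s - ?n / p" using assms(2) by (simp add: field_simps)
    moreover have "nat \<lfloor>s - ?n / p\<rfloor> \<le> nat \<lfloor>s\<rfloor>"
      using assms(2) by (intro nat_mono floor_mono) auto
    then have "real (nat \<lfloor>s - ?n / p\<rfloor> + 2) \<le> R" using assms(4) by linarith
    ultimately have "g \<notin> zygmund_space (s - ?n / p)"
      by (intro tall_peaks_imp_not_zygmund[OF assms(1)])
    then show ?thesis using 1 by (simp add: A_space_def)
  next
    case 2
    then have "s - ?n / p = 0" using assms(2) by (simp add: field_simps)
    moreover have "1 \<le> R" using assms(4) by linarith
    ultimately have "g \<notin> bmo_space" using assms(1) by (intro tall_peaks_imp_not_bmo[of R]) auto
    then show ?thesis using 2 by (simp add: A_space_def)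
  next
    case 3
    let ?\<rho> = "?n * p / (?n - s * p)"
    have "0 < ?\<rho>" using 3 assms(2) by simp
    moreover have "- (?n / ?\<rho>) = s - ?n / p" using 3 assms(2) by (simp add: field_simps)
    ultimately have "g \<notin> weak_Lp_space ?\<rho>"
      using assms(1) by (intro tall_peaks_imp_not_weak_Lp[of _ R]) auto
    then show ?thesis using 3 by (simp add: A_space_def Let_def)
  qed
qed

context spikes
begin

text \<open>
  A slice through the inner half of a spike of level \<open>n \<ge> 1\<close> sees a peak of radius
  \<open>(1/2) ^ n \<le> 1/2\<close>, and by the separation of the spikes nothing else within distance \<open>2 * M + 1\<close>.
\<close>

lemma tall_peaks_slice:
  assumes ex: "\<And>\<Lambda>. \<exists>n\<ge>1. \<exists>v<count n. \<Lambda> \<le> lam n \<and> norm (y - ctr n v) \<le> (1/2) ^ n / 2"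
  shows "tall_peaks (s - real DIM('a) / p) (real (2 * M + 1)) (\<lambda>x. spike_sum (x, y))"
  unfolding tall_peaks_def
proof (intro allI impI)
  fix \<Lambda> :: real assume \<Lambda>: "0 < \<Lambda>"
  \<comment> \<open>On the inner half of a spike the bump is at least \<open>(1/2) ^ (M + 1)\<close>.\<close>
  obtain n v where n: "1 \<le> n" "v < count n" "\<Lambda> * 2 ^ (M + 1) \<le> lam n" "norm (y - ctr n v) \<le> (1/2) ^ n / 2"
    using ex[of "\<Lambda> * 2 ^ (M + 1)"] by blast
  define i where "i = prod_encode (n, v)"
  define r where "r = (1/2::real) ^ n"
  have i: "level i = n" "centre i = (pos i, ctr n v)" "height i = amplitude n"
    using n(2) by (simp_all add: i_def level_def centre_def height_def)
  have r: "0 < r" "r \<le> 1/2"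
    using power_decreasing[of 1 n "1/2::real"] n(1) by (simp_all add: r_def)
  have amplitude: "amplitude n = lam n * r powr (s - real DIM('a) / p)"
    unfolding amplitude_def r_def half_power_eq_powr by (simp add: powr_powr algebra_simps)
  have peak: "\<Lambda> * r powr (s - real DIM('a) / p) \<le> spike_sum (x, y)" if x: "norm (x - pos i) \<le> r / 2" for x
  proof -
    have "norm (fst (x, y) - pos i) \<le> real (2 * M + 1)" using x r by simp
    then have eq: "spike_sum (x, y) = spike i (x, y)" by (rule spike_sum_near)
    let ?z = "2 ^ n *\<^sub>R ((x, y) - centre i)"
    have z: "?z = (2 ^ n *\<^sub>R (x - pos i), 2 ^ n *\<^sub>R (y - ctr n v))" by (simp add: i)
    have "?z \<bullet> ?z = (2 ^ n * norm (x - pos i))\<^sup>2 + (2 ^ n * norm (y - ctr n v))\<^sup>2"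
      unfolding z inner_Pair unfolding power2_norm_eq_inner[symmetric] norm_scaleR by simp
    also have "\<dots> \<le> (1/2)\<^sup>2 + (1/2)\<^sup>2"
    proof -
      have "2 ^ n * t \<le> 1/2" if "t \<le> r / 2" for t :: real
        using mult_left_mono[OF that, of "2 ^ n"] by (simp add: r_def power_one_over)
      then show ?thesis using x n(4) by (intro add_mono power_mono) (auto simp: r_def)
    qed
    also have "(1/2::real)\<^sup>2 + (1/2)\<^sup>2 = 1/2" by (simp add: power2_eq_square)
    finally have ge: "1/2 \<le> max 0 (1 - ?z \<bullet> ?z)" unfolding le_max_iff_disj by linarith
    have b: "(1/2) ^ (M + 1) \<le> bump (M + 1) ?z"
      unfolding bump_def by (rule power_mono[OF ge]) simp
    have "\<Lambda> * r powr (s - real DIM('a) / p) = (\<Lambda> * 2 ^ (M + 1)) * r powr (s - real DIM('a) / p) * (1/2) ^ (M + 1)"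
      by (simp add: power_one_over)
    also have "\<dots> \<le> amplitude n * bump (M + 1) ?z"
      unfolding amplitude using \<Lambda> n(3) b by (intro mult_mono b mult_right_mono) (auto simp: lam_nonneg)
    finally show ?thesis unfolding eq spike_def i .
  qed
  have zero: "spike_sum (x, y) = 0" if "r \<le> norm (x - pos i)" "norm (x - pos i) \<le> real (2 * M + 1)" for x
  proof -
    have "norm (fst ((x, y) - centre i)) \<le> norm ((x, y) - centre i)"
      using norm_fst_le[of "fst ((x, y) - centre i)" "snd ((x, y) - centre i)"] by (simp only: prod.collapse)
    then have "spike i (x, y) = 0" using that(1) by (intro spike_eq_0) (simp add: i r_def)
    then show ?thesis using that(2) spike_sum_near[of "(x, y)" i] by simp
  qed
  show "\<exists>x0 r. 0 < r \<and> r \<le> 1/2 \<and>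
      (\<forall>x. norm (x - x0) \<le> r / 2 \<longrightarrow> \<Lambda> * r powr (s - real DIM('a) / p) \<le> spike_sum (x, y)) \<and>
      (\<forall>x. r \<le> norm (x - x0) \<longrightarrow> norm (x - x0) \<le> real (2 * M + 1) \<longrightarrow> spike_sum (x, y) = 0)"
    using r peak zero by blast
qed

end

section \<open>Sparse coverings of the parameter space\<close>

lemma unit_interval_index:
  fixes t :: real
  assumes "0 \<le> t" "t \<le> real n" "0 < n"
  obtains k where "k < n" "real k \<le> t" "t \<le> real k + 1"
proof (cases "t < real n")
  case True
  have "real (nat \<lfloor>t\<rfloor>) \<le> t" "t \<le> real (nat \<lfloor>t\<rfloor>) + 1" using assms(1) by linarith+
  moreover from this True have "nat \<lfloor>t\<rfloor> < n" by linarith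
  ultimately show ?thesis using that by blast
next
  case False
  then show ?thesis using that[of "n - 1"] assms by (auto simp: of_nat_diff)
qed

definition cube :: "'a::euclidean_space \<Rightarrow> real \<Rightarrow> 'a set" where
  "cube z len = {y. \<forall>i\<in>Basis. z \<bullet> i \<le> y \<bullet> i \<and> y \<bullet> i \<le> z \<bullet> i + len}"

lemma norm_le_cube:
  fixes z :: "'a::euclidean_space"
  assumes "y \<in> cube z len"
  shows "norm (y - z) \<le> real DIM('a) * len"
proof -
  have "norm (y - z) \<le> (\<Sum>i\<in>Basis. \<bar>(y - z) \<bullet> i\<bar>)" by (rule norm_le_l1)
  also have "\<dots> \<le> (\<Sum>i\<in>(Basis::'a set). len)"
    by (rule sum_mono) (use assms in \<open>auto simp: cube_def inner_diff_left\<close>)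
  finally show ?thesis by simp
qed

lemma cube_subdivision:
  fixes z :: "'a::euclidean_space"
  assumes "0 < n" "0 < len"
  shows "\<exists>c. \<forall>y\<in>cube z len. \<exists>w<n ^ DIM('a). y \<in> cube (c w) (len / real n)"
proof -
  let ?V = "(Basis::'a set) \<rightarrow>\<^sub>E {..<n}"
  have fin: "finite ?V" by (intro finite_PiE) auto
  have card: "card ?V = n ^ DIM('a)" by (subst card_PiE) auto
  obtain f where f: "bij_betw f {0..<card ?V} ?V" using ex_bij_betw_nat_finite[OF fin] by blast
  define c where "c w = z + (len / real n) *\<^sub>R (\<Sum>i\<in>Basis. real (f w i) *\<^sub>R i)" for w
  have "\<exists>w<n ^ DIM('a). y \<in> cube (c w) (len / real n)" if y: "y \<in> cube z len" for y
  proof -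
    have "\<exists>k<n. real k * (len / real n) \<le> y \<bullet> i - z \<bullet> i \<and> y \<bullet> i - z \<bullet> i \<le> (real k + 1) * (len / real n)"
      if i: "i \<in> Basis" for i
    proof -
      let ?t = "(y \<bullet> i - z \<bullet> i) * (real n / len)"
      have d: "0 \<le> y \<bullet> i - z \<bullet> i" "y \<bullet> i - z \<bullet> i \<le> len"
        using y i by (auto simp: cube_def algebra_simps)
      have "?t \<le> len * (real n / len)" using d(2) assms by (intro mult_right_mono) auto
      then have "0 \<le> ?t" "?t \<le> real n" using d(1) assms by auto
      then obtain k where k: "k < n" "real k \<le> ?t" "?t \<le> real k + 1"
        using unit_interval_index assms(1) by blast
      have e: "?t * (len / real n) = y \<bullet> i - z \<bullet> i" using assms by simp
      have "real k * (len / real n) \<le> ?t * (len / real n)"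
        using k(2) assms by (intro mult_right_mono) auto
      moreover have "?t * (len / real n) \<le> (real k + 1) * (len / real n)"
        using k(3) assms by (intro mult_right_mono) auto
      ultimately show ?thesis using k(1) unfolding e by blast
    qed
    then obtain v where v: "\<And>i. i \<in> Basis \<Longrightarrow> v i < n \<and> real (v i) * (len / real n) \<le> y \<bullet> i - z \<bullet> i
        \<and> y \<bullet> i - z \<bullet> i \<le> (real (v i) + 1) * (len / real n)"
      by metis
    have "restrict v Basis \<in> ?V" using v by auto
    then have "restrict v Basis \<in> f ` {0..<card ?V}"
      unfolding bij_betw_imp_surj_on[OF f] .
    then obtain w where w: "w < card ?V" "f w = restrict v Basis" by (elim imageE) auto
    have "c w \<bullet> i = z \<bullet> i + (len / real n) * real (v i)" if "i \<in> Basis" for i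
      using that unfolding c_def w(2)
      by (simp add: inner_add_left inner_sum_left_Basis)
    then have "y \<in> cube (c w) (len / real n)"
      using v by (fastforce simp: cube_def algebra_simps add_divide_distrib)
    then show ?thesis using w(1) card by auto
  qed
  then show ?thesis by blast
qed

text \<open>
  The corners of a subdivision into cubes of diameter at most \<open>\<rho>\<close> serve as centres.
\<close>

lemma cube_covered_by_balls:
  fixes z :: "'a::euclidean_space"
  assumes "0 < n" "0 < len" "real DIM('a) * len \<le> real n * \<rho>"
  shows "\<exists>c. \<forall>y\<in>cube z len. \<exists>w<n ^ DIM('a). norm (y - c w) \<le> \<rho>"
proof -
  obtain c where c: "\<And>y. y \<in> cube z len \<Longrightarrow> \<exists>w<n ^ DIM('a). y \<in> cube (c w) (len / real n)"
    using cube_subdivision[OF assms(1,2)] by blast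
  have "norm (y - c w) \<le> \<rho>" if "y \<in> cube (c w) (len / real n)" for y w
  proof -
    have "norm (y - c w) \<le> real DIM('a) * (len / real n)" by (rule norm_le_cube[OF that])
    also have "\<dots> \<le> \<rho>" using assms by (simp add: field_simps)
    finally show ?thesis .
  qed
  with c show ?thesis by blast
qed

text \<open>
  The left-hand side is a constant multiple of \<open>J powr (m * (1 - u))\<close>.
\<close>

lemma cell_number_exists:
  fixes u :: real
  assumes "0 < m" "1 < u" "0 < \<epsilon>" "0 \<le> b" "0 \<le> B"
  shows "\<exists>J\<ge>1. real (J ^ m) * ((B / real J) ^ m * b) powr u \<le> \<epsilon>"
proof -
  have "((\<lambda>J. (B ^ m * b) powr u * real J powr (real m * (1 - u))) \<longlongrightarrow> (B ^ m * b) powr u * 0) sequentially"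
    using assms by (intro tendsto_mult tendsto_const tendsto_neg_powr filterlim_real_sequentially) (auto simp: mult_less_0_iff)
  then have "eventually (\<lambda>J. (B ^ m * b) powr u * real J powr (real m * (1 - u)) < \<epsilon>) sequentially"
    using assms(3) by (intro order_tendstoD(2)[of _ 0]) auto
  moreover have "eventually (\<lambda>J::nat. 1 \<le> J) sequentially" by (rule eventually_ge_at_top)
  ultimately have "eventually (\<lambda>J. 1 \<le> J \<and> (B ^ m * b) powr u * real J powr (real m * (1 - u)) < \<epsilon>) sequentially"
    by eventually_elim auto
  then obtain J where J: "1 \<le> J" "(B ^ m * b) powr u * real J powr (real m * (1 - u)) < \<epsilon>"
    by (auto dest: eventually_happens)
  have "real (J ^ m) * ((B / real J) ^ m * b) powr u = (B ^ m * b) powr u * real J powr (real m * (1 - u))"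
  proof -
    have "(B / real J) ^ m * b = (B ^ m * b) * real J powr (- real m)"
      using J(1) by (simp add: power_divide powr_minus powr_realpow field_simps)
    then have "((B / real J) ^ m * b) powr u = ((B ^ m * b) * real J powr (- real m)) powr u"
      by (simp only:)
    also have "\<dots> = (B ^ m * b) powr u * real J powr (- real m * u)"
      using assms by (subst powr_mult) (auto simp: powr_powr)
    finally have "((B / real J) ^ m * b) powr u = (B ^ m * b) powr u * real J powr (- real m * u)" .
    moreover have "real (J ^ m) = real J powr real m" using J(1) by (simp add: powr_realpow)
    ultimately show ?thesis by (simp add: powr_add[symmetric] algebra_simps)
  qed
  then show ?thesis using J by (intro exI[of _ J]) auto
qed

text \<open>
  Stage \<open>B\<close> covers the cube of side length \<open>2 * (B + 1)\<close> around the origin with \<open>lam = B + 1\<close>.  In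
  dimension \<open>m\<close> the cube is cut into \<open>J B ^ m\<close> cells, and cell \<open>w\<close> is covered by balls of radius
  \<open>(1/2) ^ n / 2\<close>, where the level \<open>n\<close> encodes the pair \<open>(B, w)\<close>, so that no two cells share a level.
  The number of balls is at most a multiple of \<open>2 ^ (n m)\<close> times the volume of the cell, whence the
  summand of level \<open>n\<close> is at most \<open>bound B (J B)\<close>, and \<open>J B\<close> is chosen so large that all cells of
  stage \<open>B\<close> together contribute at most \<open>(1/2) ^ B\<close>.
\<close>

lemma sparse_covering_exists:
  fixes p u :: real
  assumes p: "0 < p" and u: "1 < u"
  shows "\<exists>(lam :: nat \<Rightarrow> real) (count :: nat \<Rightarrow> nat) (ctr :: nat \<Rightarrow> nat \<Rightarrow> 'a::euclidean_space).
     (\<forall>n. 0 \<le> lam n) \<and>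
     summable (\<lambda>n. (real (count n) * lam n powr p * 2 powr (- (real n * real DIM('a)))) powr u) \<and>
     (\<forall>y \<Lambda>. \<exists>n\<ge>1. \<exists>v<count n. \<Lambda> \<le> lam n \<and> norm (y - ctr n v) \<le> (1/2) ^ n / 2)"
proof -
  let ?m = "DIM('a)"
  define b where "b B = real (Suc B)" for B
  define bound where "bound B J = ((8 * real ?m * b B / real J) ^ ?m * b B powr p) powr u" for B J
  have "\<exists>J\<ge>1. real (J ^ ?m) * bound B J \<le> (1/2) ^ B" for B
    unfolding bound_def by (rule cell_number_exists) (use u in \<open>auto simp: b_def\<close>)
  then obtain J where J: "\<And>B. 1 \<le> J B" "\<And>B. real (J B ^ ?m) * bound B (J B) \<le> (1/2) ^ B" by metis
  have "\<exists>cc. \<forall>B. \<forall>y\<in>cube (\<Sum>i\<in>Basis. (- b B) *\<^sub>R i) (2 * b B). \<exists>w<J B ^ ?m. y \<in> cube (cc B w :: 'a) (2 * b B / real (J B))"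
  proof (intro choice allI)
    fix B
    show "\<exists>c. \<forall>y\<in>cube (\<Sum>i\<in>Basis. (- b B) *\<^sub>R i) (2 * b B). \<exists>w<J B ^ ?m. y \<in> cube (c w :: 'a) (2 * b B / real (J B))"
      using J(1)[of B] by (intro cube_subdivision) (auto simp: b_def)
  qed
  then obtain cc where cc: "\<And>B y. y \<in> cube (\<Sum>i\<in>Basis. (- b B) *\<^sub>R i) (2 * b B) \<Longrightarrow>
      \<exists>w<J B ^ ?m. y \<in> cube (cc B w :: 'a) (2 * b B / real (J B))" by blast
  \<comment> \<open>The first component of the code makes the level at least \<open>J B\<close>, hence the
    radius of the balls small in comparison with the cell; the level is also at least \<open>B\<close>.\<close>
  define lev where "lev = (\<lambda>(B, w). prod_encode (J B, prod_encode (B, w)))"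
  \<comment> \<open>Stage and cell of a level; levels that are not \<open>valid\<close> carry no balls.\<close>
  define st where "st n = fst (prod_decode (snd (prod_decode n)))" for n
  define ix where "ix n = snd (prod_decode (snd (prod_decode n)))" for n
  define valid where "valid n \<longleftrightarrow> fst (prod_decode n) = J (st n) \<and> ix n < J (st n) ^ ?m" for n
  define N where "N n = nat \<lceil>4 * real ?m * b (st n) * 2 ^ n / real (J (st n))\<rceil>" for n
  have st_lev [simp]: "st (lev (B, w)) = B" "ix (lev (B, w)) = w" for B w
    by (simp_all add: st_def ix_def lev_def)
  have lev_ge: "J B \<le> lev (B, w)" "B \<le> lev (B, w)" for B w
  proof -
    show "J B \<le> lev (B, w)" unfolding lev_def by (simp add: le_prod_encode_1)
    have "B \<le> prod_encode (B, w)" by (rule le_prod_encode_1)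
    also have "\<dots> \<le> lev (B, w)" unfolding lev_def by (simp add: le_prod_encode_2)
    finally show "B \<le> lev (B, w)" .
  qed
  have lev_valid: "valid (lev (B, w))" if "w < J B ^ ?m" for B w
    using that unfolding valid_def st_lev by (simp add: lev_def)
  have valid_lev: "n = lev (st n, ix n)" if "valid n" for n
  proof -
    have "prod_encode (st n, ix n) = snd (prod_decode n)"
      by (simp add: st_def ix_def)
    moreover have "J (st n) = fst (prod_decode n)" using that by (simp add: valid_def)
    ultimately show ?thesis by (simp add: lev_def)
  qed
  have inj: "inj_on lev A" for A
    by (rule inj_onI) (auto simp: lev_def)
  have N: "0 < N n" "real (N n) \<le> 8 * real ?m * b (st n) / real (J (st n)) * 2 ^ n"
    "real ?m * (2 * b (st n) / real (J (st n))) \<le> real (N n) * ((1/2) ^ n / 2)" if "valid n" for n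
  proof -
    define t where "t = 4 * real ?m * b (st n) * 2 ^ n / real (J (st n))"
    have Jn: "0 < real (J (st n))" using J(1)[of "st n"] by simp
    have "J (st n) \<le> n" using valid_lev[OF that] lev_ge(1)[of "st n" "ix n"] by simp
    also have "n \<le> 2 ^ n" by simp
    finally have "real (J (st n)) \<le> 2 ^ n" using of_nat_mono[of "J (st n)" "2 ^ n", where 'a = real] by simp
    moreover have "1 * 2 ^ n \<le> 4 * real ?m * b (st n) * 2 ^ n"
    proof (rule mult_right_mono)
      have "1 \<le> real ?m" by (simp add: Suc_leI)
      then have "1 * 1 \<le> real ?m * b (st n)" by (intro mult_mono) (auto simp: b_def)
      then show "1 \<le> 4 * real ?m * b (st n)" by simp
    qed simp
    ultimately have "real (J (st n)) \<le> 4 * real ?m * b (st n) * 2 ^ n" by linarith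
    then have t: "1 \<le> t" unfolding t_def using Jn by (simp only: le_divide_eq_1_pos)
    have le: "t \<le> real (N n)" "real (N n) \<le> t + 1"
      unfolding N_def t_def[symmetric] using t by linarith+
    show "0 < N n" using le t by linarith
    have "real (N n) \<le> 2 * t" using le t by linarith
    then show "real (N n) \<le> 8 * real ?m * b (st n) / real (J (st n)) * 2 ^ n" by (simp add: t_def)
    have "real ?m * (2 * b (st n) / real (J (st n))) = t * ((1/2) ^ n / 2)"
      by (simp add: t_def power_one_over)
    also have "\<dots> \<le> real (N n) * ((1/2) ^ n / 2)" using le(1) by (intro mult_right_mono) auto
    finally show "real ?m * (2 * b (st n) / real (J (st n))) \<le> real (N n) * ((1/2) ^ n / 2)" .
  qed
  have "\<exists>ctr. \<forall>n. valid n \<longrightarrow> (\<forall>y\<in>cube (cc (st n) (ix n)) (2 * b (st n) / real (J (st n))).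
      \<exists>v<N n ^ ?m. norm (y - ctr n v) \<le> (1/2) ^ n / 2)"
  proof (intro choice allI)
    fix n
    show "\<exists>c. valid n \<longrightarrow> (\<forall>y\<in>cube (cc (st n) (ix n)) (2 * b (st n) / real (J (st n))).
      \<exists>v<N n ^ ?m. norm (y - c v) \<le> (1/2) ^ n / 2)"
    proof (cases "valid n")
      case True
      have "0 < 2 * b (st n) / real (J (st n))" using J(1)[of "st n"] by (simp add: b_def)
      then show ?thesis using cube_covered_by_balls[OF N(1)[OF True] _ N(3)[OF True]] by blast
    qed simp
  qed
  then obtain ctr where ctr: "\<And>n y. valid n \<Longrightarrow> y \<in> cube (cc (st n) (ix n)) (2 * b (st n) / real (J (st n))) \<Longrightarrow>
      \<exists>v<N n ^ ?m. norm (y - ctr n v) \<le> (1/2) ^ n / 2" by blast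
  define lam where "lam n = b (st n)" for n
  define count where "count n = (if valid n then N n ^ ?m else 0)" for n
  have b0: "0 \<le> b B" for B by (simp add: b_def)
  have cover: "\<exists>n\<ge>1. \<exists>v<count n. \<Lambda> \<le> lam n \<and> norm (y - ctr n v) \<le> (1/2) ^ n / 2" for y :: 'a and \<Lambda>
  proof -
    obtain B where B: "max (norm y) \<Lambda> \<le> real B" using real_arch_simple by blast
    have y: "\<bar>y \<bullet> i\<bar> \<le> b B" if "i \<in> Basis" for i
      using Basis_le_norm[OF that, of y] B by (simp add: b_def)
    have "y \<in> cube (\<Sum>i\<in>Basis. (- b B) *\<^sub>R i) (2 * b B)"
      unfolding cube_def
    proof (intro CollectI ballI)
      fix i :: 'a assume i: "i \<in> Basis"
      have "(\<Sum>i\<in>Basis. (- b B) *\<^sub>R i) \<bullet> i = - b B" using i by (rule inner_sum_left_Basis)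
      then show "(\<Sum>i\<in>Basis. (- b B) *\<^sub>R i) \<bullet> i \<le> y \<bullet> i \<and> y \<bullet> i \<le> (\<Sum>i\<in>Basis. (- b B) *\<^sub>R i) \<bullet> i + 2 * b B"
        using y[OF i] by linarith
    qed
    then obtain w where w: "w < J B ^ ?m" "y \<in> cube (cc B w) (2 * b B / real (J B))" using cc by blast
    have v: "valid (lev (B, w))" by (rule lev_valid[OF w(1)])
    then obtain v where "v < N (lev (B, w)) ^ ?m" "norm (y - ctr (lev (B, w)) v) \<le> (1/2) ^ lev (B, w) / 2"
      using ctr[OF v, of y] w(2) by auto
    moreover have "1 \<le> lev (B, w)" using lev_ge(1)[of B w] J(1)[of B] by linarith
    moreover have "\<Lambda> \<le> lam (lev (B, w))" using B by (simp add: lam_def b_def)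
    ultimately show ?thesis using v by (intro exI[of _ "lev (B, w)"]) (auto simp: count_def)
  qed
  define a where "a n = real (count n) * lam n powr p * 2 powr (- (real n * real ?m))" for n
  have a_valid: "a n powr u \<le> bound (st n) (J (st n))" if "valid n" for n
  proof -
    have "real (count n) \<le> (8 * real ?m * b (st n) / real (J (st n)) * 2 ^ n) ^ ?m"
      unfolding count_def using that N(2)[OF that] by (auto intro: power_mono)
    also have "\<dots> = (8 * real ?m * b (st n) / real (J (st n))) ^ ?m * 2 powr (real n * real ?m)"
      unfolding power_mult_distrib power_mult[symmetric]
      by (simp add: powr_realpow flip: of_nat_mult)
    finally have "a n \<le> (8 * real ?m * b (st n) / real (J (st n))) ^ ?m * 2 powr (real n * real ?m) * b (st n) powr p * 2 powr (- (real n * real ?m))"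
      unfolding a_def lam_def by (intro mult_right_mono) auto
    also have "\<dots> = (8 * real ?m * b (st n) / real (J (st n))) ^ ?m * b (st n) powr p * (2 powr (real n * real ?m) * 2 powr (- (real n * real ?m)))"
      by (simp only: mult_ac)
    also have "2 powr (real n * real ?m) * 2 powr (- (real n * real ?m)) = (1::real)"
      unfolding powr_add[symmetric] by simp
    finally have "a n \<le> (8 * real ?m * b (st n) / real (J (st n))) ^ ?m * b (st n) powr p" by simp
    moreover have "0 \<le> a n" by (simp add: a_def)
    ultimately show ?thesis unfolding bound_def using u by (intro powr_mono2) auto
  qed
  have "summable (\<lambda>n. a n powr u)"
  proof (rule summableI_nonneg_bounded)
    fix K
    let ?T = "SIGMA B:{..<K}. {..<J B ^ ?m}"
    have "(\<Sum>n<K. a n powr u) = (\<Sum>n\<in>{n. n < K \<and> valid n}. a n powr u)"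
      by (rule sum.mono_neutral_right) (auto simp: a_def count_def)
    also have "\<dots> \<le> (\<Sum>n\<in>{n. n < K \<and> valid n}. bound (st n) (J (st n)))"
      by (rule sum_mono) (use a_valid in auto)
    also have "\<dots> \<le> (\<Sum>n\<in>lev ` ?T. bound (st n) (J (st n)))"
    proof (rule sum_mono2)
      show "{n. n < K \<and> valid n} \<subseteq> lev ` ?T"
      proof safe
        fix n assume n: "n < K" "valid n"
        have "st n \<le> n" using valid_lev[OF n(2)] lev_ge(2)[of "st n" "ix n"] by simp
        then have "(st n, ix n) \<in> ?T" using n by (auto simp: valid_def)
        then show "n \<in> lev ` ?T" by (subst valid_lev[OF n(2)]) (rule imageI)
      qed
    qed (auto simp: bound_def)
    also have "\<dots> = (\<Sum>x\<in>?T. bound (fst x) (J (fst x)))"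
      by (subst sum.reindex[OF inj]) (auto intro!: sum.cong)
    also have "\<dots> = (\<Sum>B<K. real (J B ^ ?m) * bound B (J B))"
      by (subst sum.Sigma[symmetric, where g = "\<lambda>B w. bound B (J B)", simplified case_prod_unfold]) auto
    also have "\<dots> \<le> (\<Sum>B<K. (1/2) ^ B)" by (rule sum_mono) (rule J(2))
    also have "\<dots> \<le> 1 / (1 - 1/2)" by (rule geometric_partial_sum_le) auto
    finally show "(\<Sum>n<K. a n powr u) \<le> 1 / (1 - 1/2)" .
  qed simp
  moreover have "0 \<le> lam n" for n by (simp add: lam_def b0)
  ultimately show ?thesis unfolding a_def using cover by blast
qed

section \<open>The counterexample\<close>

theorem theorem1p5:
  fixes p s :: real and q :: ennreal
  assumes "0 < p" and "ennreal p < q"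
    and "s > sigma_p (CARD('d::finite) + CARD('m::finite)) p"
  shows "\<exists>f :: (real ^ 'd) \<times> (real ^ 'm) \<Rightarrow> real.
           f \<in> besov_space s (ennreal p) q \<and>
           (AE y in lebesgue. (\<lambda>x. f (x, y)) \<notin> A_space s p)"
proof -
  have s: "0 < s" using assms(3) by (rule order.strict_trans1[rotated]) (simp add: sigma_p_def)
  \<comment> \<open>For \<open>q = \<infinity>\<close> any \<open>u > 1\<close> is good enough.\<close>
  obtain u where u: "1 < u" "q = \<infinity> \<or> q = ennreal (p * u)"
  proof (cases q)
    case (real q')
    then have "p < q'" using assms(1,2) by (simp add: ennreal_less_iff)
    then show ?thesis using that[of "q' / p"] real assms(1) by simp
  next
    case top
    then show ?thesis using that[of 2] by simp
  qed
  obtain lam :: "nat \<Rightarrow> real" and count :: "nat \<Rightarrow> nat" and ctr :: "nat \<Rightarrow> nat \<Rightarrow> real ^ 'm" where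
    lam: "\<And>n. 0 \<le> lam n"
    and sum: "summable (\<lambda>n. (real (count n) * lam n powr p * 2 powr (- (real n * real DIM(real ^ 'm)))) powr u)"
    and cover: "\<And>y \<Lambda>. \<exists>n\<ge>1. \<exists>v<count n. \<Lambda> \<le> lam n \<and> norm (y - ctr n v) \<le> (1/2) ^ n / 2"
    using sparse_covering_exists[OF assms(1) u(1), where 'a = "real ^ 'm"] by blast
  obtain e :: "real ^ 'd" where e: "norm e = 1" using vector_choose_size[of 1] by auto
  define M where "M = nat \<lfloor>s\<rfloor> + 1"
  interpret spikes p s M lam count ctr e
  proof
    show "s < real M" unfolding M_def by linarith
  qed (use assms(1) s lam e in auto)
  have "spike_sum \<in> besov_space s (ennreal p) q"
    using u sum by (intro spike_sum_in_besov_space[of u]) (auto simp: M_def mass_def[abs_def])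
  moreover have "(\<lambda>x. spike_sum (x, y)) \<notin> A_space s p" for y
    by (rule tall_peaks_imp_not_A_space[OF tall_peaks_slice[OF cover] assms(1) s]) (simp add: M_def)
  ultimately show ?thesis by blast
qed

end
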